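(* Let $n,k\geq3$ be integers. The following local projective billiards with $n$ vertices are $k$-reflective: (1) ($n=k=3$) the right-spherical billiard based at any points $P_1,P_2,P_3$ is $3$-reflective; (2) ($n=k=4$) the centrally-projective quadrilateral based at any points $O,P_1,P_2,P_3,P_4$ is $4$-reflective, where $O$ is the intersection point of $P_1P_3$ and $P_2P_4$; (3) ($n=k$ even) the centrally-projective polygon based at points $O,P_1,P_2,\dots,P_n$ is $n$-reflective, where $n\ge4$ is an even integer, $P_1,\dots,P_n$ enumerate the vertices of a regular polygon in the clockwise (or counterclockwise) order and $O$ is its center of symmetry; (4) ($k=2n$) the centrally-projective polygon based at any points $O,P_1,P_2,\dots,P_n$ is $2n$-reflective, where $n\geq3$ is an integer.
   Context: For distinct points $O,P,Q\in\mathbb{RP}^2$ not on the same line, let $(PQ)_O$ denote the line $PQ$ endowed with the field of transverse lines which associates to $p\in PQ$ the line $pO$. Given three points $P_1,P_2,P_3$ not on the same line, the right-spherical billiard based at $P_1,P_2,P_3$ is the local projective billiard $((P_1P_2)_{P_3},(P_2P_3)_{P_1},(P_3P_1)_{P_2})$. Given points $O,P_1,\dots,P_n$ such that for each $j$ modulo $n$ the points $P_j,P_{j+1},O$ are not on the same line, the centrally-projective polygon based at $O,P_1,\dots,P_n$ is the local projective billiard $((P_1P_2)_O,(P_2P_3)_O,\dots,(P_nP_1)_O)$; for $n=4$ it is called a quadrilateral. Such a billiard has classical boundaries $a_1,\dots,a_n$ (the lines $a_j=P_jP_{j+1}$, indices modulo $n$), with a field of transverse lines $L_j$ on $a_j$.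 Projective reflection law at $p\in a_j$: an oriented line $\ell'$ through $p$ is obtained from an oriented line $\ell$ through $p$ if the quadruple of lines $(\ell,\ell',L_j(p),a_j)$ is harmonic, i.e. the unique non-trivial projective involution of the pencil of lines through $p$ fixing $L_j(p)$ and $a_j$ permutes $\ell$ and $\ell'$, and the orientations of $\ell$ and $\ell'$ with respect to $a_j$ are opposite. An orbit is a sequence of points $(p_j)$ such that for each $j$: $p_j\in a_{j\bmod n}$, $p_j\neq p_{j+1}$, the line $p_jp_{j+1}$ is oriented from $p_j$ to $p_{j+1}$ and is transverse to both $a_{j\bmod n}$ and $a_{j+1\bmod n}$, and $p_jp_{j+1}$ is obtained from $p_{j-1}p_j$ by the projective reflection law at $p_j$. For $k$ a multiple of $n$, an orbit $(p_1,\dots,p_k)$ is $k$-periodic if $(p_1,\dots,p_k,p_1,p_2)$ is an orbit. The billiard is $k$-reflective if there is a non-empty open subset $U_1\times U_2\subset a_1\times a_2$ such that to any pair $(p_1,p_2)\in U_1\times U_2$ corresponds a $k$-periodic orbit $(p_1,p_2,\dots,p_k)$.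
   Formalization: Part (4) is proved only for odd n and for polygons whose consecutive vertices P_j, P_{j+1}, P_{j+2} are never on one line; for even n it fails for general points (e.g. a rectangle with O off the diagonals' intersection), and with two consecutive sides on one line no orbit exists. *)

theory Defs
  imports "HOL-Analysis.Analysis"
begin

section \<open>The real projective plane\<close>

typedef rp2 = "{V :: (real^3) set. subspace V \<and> dim V = 1}"
proof -
  have "dim (span {axis 1 1 :: real^3}) = 1"
    by (simp add: axis_eq_0_iff)
  then show ?thesis
    using subspace_span by blast
qed

text \<open>Only meaningful for nonzero vectors.\<close>
definition pt :: "real^3 \<Rightarrow> rp2" where
  "pt v = Abs_rp2 (span {v})"

text \<open>The quotient topology of \<open>\<real>\<^sup>3 - {0}\<close>.\<close>
instantiation rp2 :: topological_space
begin

definition open_rp2 :: "rp2 set \<Rightarrow> bool" where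
  "open_rp2 U \<longleftrightarrow> open {v. v \<noteq> 0 \<and> pt v \<in> U}"

instance
proof
  have "{v. v \<noteq> 0 \<and> pt v \<in> UNIV} = - {0}"
    by auto
  then show "open (UNIV :: rp2 set)"
    by (simp add: open_rp2_def open_Compl)
next
  fix S T :: "rp2 set"
  assume "open S" "open T"
  moreover have "{v. v \<noteq> 0 \<and> pt v \<in> S \<inter> T}
      = {v. v \<noteq> 0 \<and> pt v \<in> S} \<inter> {v. v \<noteq> 0 \<and> pt v \<in> T}"
    by auto
  ultimately show "open (S \<inter> T)"
    by (simp add: open_rp2_def open_Int)
next
  fix K :: "rp2 set set"
  assume "\<forall>S\<in>K. open S"
  moreover have "{v. v \<noteq> 0 \<and> pt v \<in> \<Union>K} = (\<Union>S\<in>K. {v. v \<noteq> 0 \<and> pt v \<in> S})"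
    by auto
  ultimately show "open (\<Union>K)"
    by (simp add: open_rp2_def open_UN)
qed

end

text \<open>The points of \<open>\<real>P\<^sup>2\<close> contained in a linear subspace of \<open>\<real>\<^sup>3\<close>.\<close>
definition points_of :: "(real^3) set \<Rightarrow> rp2 set" where
  "points_of V = {p. Rep_rp2 p \<subseteq> V}"

definition is_line :: "rp2 set \<Rightarrow> bool" where
  "is_line l \<longleftrightarrow> (\<exists>V. subspace V \<and> dim V = 2 \<and> l = points_of V)"

definition aligned :: "rp2 \<Rightarrow> rp2 \<Rightarrow> rp2 \<Rightarrow> bool" where
  "aligned P Q R \<longleftrightarrow> (\<exists>l. is_line l \<and> P \<in> l \<and> Q \<in> l \<and> R \<in> l)"

text \<open>The line \<open>PQ\<close> when \<open>P \<noteq> Q\<close>; the degenerate value for \<open>P = Q\<close> is \<open>{P}\<close>.\<close>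
definition line_through :: "rp2 \<Rightarrow> rp2 \<Rightarrow> rp2 set" where
  "line_through P Q = points_of (span (Rep_rp2 P \<union> Rep_rp2 Q))"

definition proj_map :: "(real^3 \<Rightarrow> real^3) \<Rightarrow> rp2 \<Rightarrow> rp2" where
  "proj_map T p = Abs_rp2 (T ` Rep_rp2 p)"

section \<open>Harmonic quadruples of lines\<close>

definition pencil :: "rp2 \<Rightarrow> rp2 set set" where
  "pencil p = {l. is_line l \<and> p \<in> l}"

text \<open>The pencil at \<open>p\<close> is the projective line of the quotient of \<open>\<real>\<^sup>3\<close> by \<open>p\<close>, and
  every automorphism of this quotient lifts to an automorphism of \<open>\<real>\<^sup>3\<close> that preserves \<open>p\<close>.\<close>
definition pencil_projective :: "rp2 \<Rightarrow> (rp2 set \<Rightarrow> rp2 set) \<Rightarrow> bool" where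
  "pencil_projective p f \<longleftrightarrow>
     (\<exists>T. linear T \<and> bij T \<and> proj_map T p = p \<and> (\<forall>l\<in>pencil p. f l = proj_map T ` l))"

definition nontrivial_pencil_involution :: "rp2 \<Rightarrow> (rp2 set \<Rightarrow> rp2 set) \<Rightarrow> bool" where
  "nontrivial_pencil_involution p f \<longleftrightarrow> pencil_projective p f \<and>
     (\<forall>l\<in>pencil p. f (f l) = l) \<and> (\<exists>l\<in>pencil p. f l \<noteq> l)"

text \<open>Used only for \<open>m \<noteq> a\<close>; the involution is then unique.\<close>
definition harmonic_lines :: "rp2 \<Rightarrow> rp2 set \<Rightarrow> rp2 set \<Rightarrow> rp2 set \<Rightarrow> rp2 set \<Rightarrow> bool" where
  "harmonic_lines p l l' m a \<longleftrightarrow>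
     {l, l', m, a} \<subseteq> pencil p \<and>
     (\<exists>f. nontrivial_pencil_involution p f \<and> f m = m \<and> f a = a \<and> f l = l' \<and> f l' = l)"

section \<open>Oriented lines and the reflection law\<close>

text \<open>An oriented projective line is encoded by an oriented linear plane \<open>V\<close>, that is, by the set
  of positive bases of \<open>V\<close>.  In the direction of the orientation, \<open>pt u\<close> moves towards \<open>pt v\<close>
  along \<open>t \<mapsto> pt (u + t v)\<close>, \<open>t \<ge> 0\<close>, whenever \<open>(u, v)\<close> is a positive basis; this is consistent,
  since \<open>(u, v)\<close> and \<open>(- u, - v)\<close> define the same orientation of \<open>V\<close>.\<close>
type_synonym oriented_line = "((real^3) \<times> (real^3)) set"

definition positive_bases :: "real^3 \<Rightarrow> real^3 \<Rightarrow> oriented_line" where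
  "positive_bases u v =
     {(a *\<^sub>R u + b *\<^sub>R v, c *\<^sub>R u + d *\<^sub>R v) | a b c d. a * d - b * c > 0}"

definition is_oriented_line :: "oriented_line \<Rightarrow> bool" where
  "is_oriented_line \<Lambda> \<longleftrightarrow>
     (\<exists>u v. u \<noteq> v \<and> independent {u, v} \<and> \<Lambda> = positive_bases u v)"

definition line_of :: "oriented_line \<Rightarrow> rp2 set" where
  "line_of \<Lambda> = {pt u | u v. (u, v) \<in> \<Lambda>}"

text \<open>Near \<open>p = pt w\<close> the line \<open>a\<close>, of equation \<open>n \<bullet> x = 0\<close>, has two sides, told apart by the sign
  of \<open>n \<bullet> x\<close> for \<open>x\<close> near \<open>w\<close>.  An oriented line with positive basis \<open>(w, v)\<close> crosses \<open>a\<close> at \<open>p\<close>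
  towards the side given by the sign of \<open>n \<bullet> v\<close>.  The condition depends neither on \<open>w\<close>, \<open>v\<close>, \<open>v'\<close>
  nor on \<open>n\<close>, and it implies that both lines are transverse to \<open>a\<close>.\<close>
definition opposite_orientations :: "rp2 \<Rightarrow> rp2 set \<Rightarrow> oriented_line \<Rightarrow> oriented_line \<Rightarrow> bool" where
  "opposite_orientations p a \<Lambda> \<Lambda>' \<longleftrightarrow>
     (\<exists>w v v' n. p = pt w \<and> (w, v) \<in> \<Lambda> \<and> (w, v') \<in> \<Lambda>' \<and>
        a = points_of {x. n \<bullet> x = 0} \<and> n \<bullet> w = 0 \<and> (n \<bullet> v) * (n \<bullet> v') < 0)"

definition reflection_law ::
  "rp2 \<Rightarrow> rp2 set \<Rightarrow> rp2 set \<Rightarrow> oriented_line \<Rightarrow> oriented_line \<Rightarrow> bool" where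
  "reflection_law p m a \<Lambda> \<Lambda>' \<longleftrightarrow>
     harmonic_lines p (line_of \<Lambda>) (line_of \<Lambda>') m a \<and> opposite_orientations p a \<Lambda> \<Lambda>'"

section \<open>Local projective billiards with straight boundaries\<close>

text \<open>A classical boundary together with its field of transverse lines.\<close>
type_synonym framed_line = "rp2 set \<times> (rp2 \<Rightarrow> rp2 set)"

text \<open>The \<open>n\<close> framed boundaries in order, indexed from 0.\<close>
type_synonym billiard = "framed_line list"

definition boundary :: "billiard \<Rightarrow> nat \<Rightarrow> rp2 set" where
  "boundary B j = fst (B ! (j mod length B))"

definition transverse_field :: "billiard \<Rightarrow> nat \<Rightarrow> rp2 \<Rightarrow> rp2 set" where
  "transverse_field B j = snd (B ! (j mod length B))"

text \<open>In \<open>\<real>P\<^sup>2\<close> both orientations of the line \<open>pq\<close> lead from \<open>p\<close> to \<open>q\<close> (along the two arcs between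
  them), so an orbit comes with a choice \<open>\<omega> p q\<close> of one of them.  As \<open>\<omega>\<close> depends on the two points
  only, a segment that occurs twice in the sequence, such as the first and the last one of a
  periodic orbit, carries the same orientation both times.  Two lines are transverse iff they are
  different.\<close>
definition orbit :: "billiard \<Rightarrow> rp2 list \<Rightarrow> bool" where
  "orbit B ps \<longleftrightarrow>
     (\<forall>j < length ps. ps ! j \<in> boundary B j) \<and>
     (\<exists>\<omega>. (\<forall>j. j + 1 < length ps \<longrightarrow>
              ps ! j \<noteq> ps ! (j + 1) \<and>
              is_oriented_line (\<omega> (ps ! j) (ps ! (j + 1))) \<and>
              line_of (\<omega> (ps ! j) (ps ! (j + 1))) = line_through (ps ! j) (ps ! (j + 1)) \<and>
              line_through (ps ! j) (ps ! (j + 1)) \<noteq> boundary B j \<and>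
              line_through (ps ! j) (ps ! (j + 1)) \<noteq> boundary B (j + 1)) \<and>
          (\<forall>j. j + 2 < length ps \<longrightarrow>
              reflection_law (ps ! (j + 1))
                (transverse_field B (j + 1) (ps ! (j + 1))) (boundary B (j + 1))
                (\<omega> (ps ! j) (ps ! (j + 1))) (\<omega> (ps ! (j + 1)) (ps ! (j + 2)))))"

definition periodic_orbit :: "billiard \<Rightarrow> nat \<Rightarrow> rp2 list \<Rightarrow> bool" where
  "periodic_orbit B k ps \<longleftrightarrow>
     length B dvd k \<and> length ps = k \<and> orbit B (ps @ [ps ! 0, ps ! 1])"

definition reflective :: "nat \<Rightarrow> billiard \<Rightarrow> bool" where
  "reflective k B \<longleftrightarrow>
     (\<exists>U1 U2. U1 \<noteq> {} \<and> U2 \<noteq> {} \<and>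
        openin (top_of_set (boundary B 0)) U1 \<and> openin (top_of_set (boundary B 1)) U2 \<and>
        (\<forall>p1\<in>U1. \<forall>p2\<in>U2. \<exists>ps. periodic_orbit B k ps \<and> ps ! 0 = p1 \<and> ps ! 1 = p2))"

section \<open>Right-spherical billiards and centrally-projective polygons\<close>

text \<open>\<open>(PQ)\<^sub>R\<close>\<close>
definition framed :: "rp2 \<Rightarrow> rp2 \<Rightarrow> rp2 \<Rightarrow> framed_line" where
  "framed P Q R = (line_through P Q, \<lambda>p. line_through p R)"

definition right_spherical :: "rp2 \<Rightarrow> rp2 \<Rightarrow> rp2 \<Rightarrow> billiard" where
  "right_spherical P1 P2 P3 = [framed P1 P2 P3, framed P2 P3 P1, framed P3 P1 P2]"

definition centrally_projective :: "rp2 \<Rightarrow> rp2 list \<Rightarrow> billiard" where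
  "centrally_projective C Ps =
     map (\<lambda>j. framed (Ps ! j) (Ps ! ((j + 1) mod length Ps)) C) [0..<length Ps]"

definition central_base :: "rp2 \<Rightarrow> rp2 list \<Rightarrow> bool" where
  "central_base C Ps \<longleftrightarrow>
     (\<forall>j < length Ps. \<not> aligned (Ps ! j) (Ps ! ((j + 1) mod length Ps)) C)"

text \<open>Consecutive sides lie on different lines.  Otherwise no orbit exists at all: if \<open>a\<^sub>j = a\<^sub>j\<^sub>+\<^sub>1\<close>,
  then the line through \<open>p\<^sub>j\<close> and \<open>p\<^sub>j\<^sub>+\<^sub>1\<close> is \<open>a\<^sub>j\<close>, which is not transverse to \<open>a\<^sub>j\<close>.\<close>
definition nondegenerate_polygon :: "rp2 list \<Rightarrow> bool" where
  "nondegenerate_polygon Ps \<longleftrightarrow>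
     (\<forall>j < length Ps. \<not> aligned (Ps ! j) (Ps ! ((j + 1) mod length Ps))
                                  (Ps ! ((j + 2) mod length Ps)))"

text \<open>The Euclidean plane, identified with the complex numbers, as an affine chart.\<close>
definition affine_pt :: "complex \<Rightarrow> rp2" where
  "affine_pt z = pt (vector [Re z, Im z, 1])"

text \<open>\<open>zs\<close> enumerates, counterclockwise or clockwise, the vertices of a regular polygon with
  center \<open>c\<close>; the modulus of \<open>\<rho>\<close> is the circumradius, its argument locates the first vertex.\<close>
definition regular_polygon :: "complex \<Rightarrow> complex list \<Rightarrow> bool" where
  "regular_polygon c zs \<longleftrightarrow>
     (\<exists>\<rho>. \<rho> \<noteq> 0 \<and>
        ((\<forall>j < length zs. zs ! j = c + \<rho> * cis (2 * pi * real j / real (length zs))) \<or>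
         (\<forall>j < length zs. zs ! j = c + \<rho> * cis (- 2 * pi * real j / real (length zs)))))"

end

theory Submission
  imports Defs
begin

unbundle cross3_syntax

text \<open>
All boundaries are straight lines, and the transverse lines of each boundary pass through one point.
Therefore the reflection at a boundary does not depend on the point of reflection: it is the harmonic
homology whose axis is the boundary and whose center is that point.  Dually, an oriented line is a
normal vector \<open>m\<close> up to positive scaling, and the reflection, orientations included, is the linear
involution \<open>m \<mapsto> 2 (c \<bullet> m) / (n \<bullet> c) n - m\<close>, where \<open>n\<close> is a normal of the boundary and \<open>c\<close> spans the center
(\<open>reflection_law_dual\<close>).  If consecutive boundaries differ, the billiard is thus \<open>k\<close>-reflective as soon
as the product of \<open>k\<close> consecutive such involutions is the identity.  All other requirements on an orbit are open conditions on the
initial segment, given by finitely many linear forms that do not vanish identically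
(\<open>reflective_of_closed_trajectories\<close>).  A segment may recur along an orbit, and it then has to carry
the same orientation each time; this follows from an invariant of the reflections that is
odd in \<open>m\<close>.

In the right-spherical case the three involutions are diagonal, with two entries \<open>- 1\<close>, in the
coordinates dual to the vertices, so their product is the identity.

In the centrally-projective case, normalize all normals
by \<open>n \<bullet> c = 1\<close>.  Every involution preserves \<open>c \<bullet> m\<close>, and the product of an even number \<open>k\<close> of them is
the identity if the alternating sum of the normals vanishes (\<open>reflective_centrally_projective\<close>).  For
a quadrilateral centered at the intersection of its diagonals and for regular polygons with an even
number of sides this is a property of the normals; for a polygon with an odd number of sides, run
through twice, each normal occurs once with either sign.
\<close>

section \<open>Points and lines in homogeneous coordinates\<close>

text \<open>Points and lines of the projective plane are both given by vectors of \<open>\<real>\<^sup>3\<close>: a line by a normal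
vector, a point by a spanning vector.  Then incidence is orthogonality, and the cross product both
joins points and intersects lines.\<close>
abbreviation dual_line :: "real^3 \<Rightarrow> rp2 set" where
  "dual_line m \<equiv> points_of {x. m \<bullet> x = 0}"

lemma cross_eq_0_imp_scaleR:
  fixes a b :: "real^3"
  assumes "a \<noteq> 0" "a \<times> b = 0"
  obtains s where "b = s *\<^sub>R a"
proof -
  have "(a \<bullet> a) *\<^sub>R b = (a \<bullet> b) *\<^sub>R a"
    using Lagrange[of a a b] assms(2) by simp
  moreover have "b = (1 / (a \<bullet> a)) *\<^sub>R ((a \<bullet> a) *\<^sub>R b)"
    using assms(1) by simp
  ultimately have "b = ((a \<bullet> b) / (a \<bullet> a)) *\<^sub>R a" by simp
  then show ?thesis using that by blast
qed

lemma orthogonal_complement_eq_span: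
  fixes m x y :: "real^3"
  assumes "m \<noteq> 0" "m \<bullet> x = 0" "m \<bullet> y = 0" "x \<times> y \<noteq> 0"
  shows "{z. m \<bullet> z = 0} = span {x, y}"
proof
  show "span {x, y} \<subseteq> {z. m \<bullet> z = 0}"
    by (rule span_minimal) (use assms in \<open>auto intro: subspace_hyperplane\<close>)
  show "{z. m \<bullet> z = 0} \<subseteq> span {x, y}"
  proof
    fix z assume "z \<in> {z. m \<bullet> z = 0}"
    then have z: "m \<bullet> z = 0" by simp
    define w where "w = x \<times> y"
    have "m \<times> w = 0" unfolding w_def Lagrange using assms by simp
    then obtain s where "w = s *\<^sub>R m"
      using cross_eq_0_imp_scaleR assms(1) by blast
    then have wz: "w \<bullet> z = 0" using z by simp
    have "(w \<bullet> w) *\<^sub>R z = ((z \<times> y) \<bullet> w) *\<^sub>R x + ((x \<times> z) \<bullet> w) *\<^sub>R y + (w \<bullet> z) *\<^sub>R w"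
      unfolding w_def
      by (simp add: vec_eq_iff forall_3 cross3_def inner_vec_def sum_3 algebra_simps)
    then have "(w \<bullet> w) *\<^sub>R z = ((z \<times> y) \<bullet> w) *\<^sub>R x + ((x \<times> z) \<bullet> w) *\<^sub>R y"
      using wz by simp
    moreover have "z = (1 / (w \<bullet> w)) *\<^sub>R ((w \<bullet> w) *\<^sub>R z)"
      using assms(4) w_def by simp
    moreover have "((z \<times> y) \<bullet> w) *\<^sub>R x + ((x \<times> z) \<bullet> w) *\<^sub>R y \<in> span {x, y}"
      by (intro span_mul span_add span_base) auto
    ultimately show "z \<in> span {x, y}" by (metis span_mul)
  qed
qed

lemma Rep_pt:
  assumes "x \<noteq> 0" shows "Rep_rp2 (pt x) = span {x}"
  unfolding pt_def using assms
  by (intro Abs_rp2_inverse) (simp add: subspace_span)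

lemma rp2_cases:
  obtains x where "x \<noteq> 0" "p = pt x"
proof -
  have V: "subspace (Rep_rp2 p)" "dim (Rep_rp2 p) = 1"
    using Rep_rp2[of p] by auto
  obtain B where B: "B \<subseteq> Rep_rp2 p" "independent B" "Rep_rp2 p \<subseteq> span B" "card B = 1"
    using basis_exists[of "Rep_rp2 p"] V(2) by metis
  then obtain x where x: "B = {x}" by (auto simp: card_1_singleton_iff)
  then have "x \<noteq> 0" using B(2) dependent_single by blast
  moreover have "Rep_rp2 p = span {x}"
    using B x V(1) by (metis span_minimal subset_antisym)
  then have "p = pt x" unfolding pt_def by (metis Rep_rp2_inverse)
  ultimately show ?thesis using that by blast
qed

lemma pt_eq_iff:
  assumes "x \<noteq> 0" "y \<noteq> 0"
  shows "pt x = pt y \<longleftrightarrow> x \<times> y = 0"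
proof
  assume "pt x = pt y"
  then have "y \<in> span {x}"
    using assms Rep_pt by (metis insertI1 span_base)
  then show "x \<times> y = 0" by (auto simp: span_singleton cross_mult_right)
next
  assume "x \<times> y = 0"
  then obtain s where s: "y = s *\<^sub>R x" using assms cross_eq_0_imp_scaleR by blast
  then have "s \<noteq> 0" using assms by auto
  then have "x = (1 / s) *\<^sub>R y" using s by simp
  then have "span {x} = span {y}"
    using s by (intro span_eq[THEN iffD2])
      (metis empty_subsetI insert_subset insertI1 span_base span_mul)
  then show "pt x = pt y" by (simp add: pt_def)
qed

lemma pt_scaleR: "s \<noteq> 0 \<Longrightarrow> pt (s *\<^sub>R x) = pt x"
  by (cases "x = 0") (simp_all add: pt_eq_iff cross_mult_left)

lemma pt_minus: "pt (- x) = pt x"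
  using pt_scaleR[of "- 1" x] by simp

lemma pt_in_points_of:
  assumes "x \<noteq> 0" "subspace V"
  shows "pt x \<in> points_of V \<longleftrightarrow> x \<in> V"
  unfolding points_of_def using assms
  by (auto simp: Rep_pt span_base intro: span_minimal[THEN subsetD])

lemma pt_in_dual_line: "x \<noteq> 0 \<Longrightarrow> pt x \<in> dual_line m \<longleftrightarrow> m \<bullet> x = 0"
  by (simp add: pt_in_points_of subspace_hyperplane)

text \<open>Otherwise \<open>m \<times> (m \<times> m')\<close> would span a point of the first line that is not on the second.\<close>
lemma dual_line_eqD:
  assumes "dual_line m = dual_line m'"
  shows "m \<times> m' = 0"
proof -
  define k where "k = m \<times> m'"
  have "m \<times> k = 0"
  proof (rule ccontr)
    assume k: "m \<times> k \<noteq> 0"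
    then have "pt (m \<times> k) \<in> dual_line m"
      by (simp add: pt_in_dual_line dot_cross_self)
    then have "m' \<bullet> (m \<times> k) = 0"
      using assms pt_in_dual_line[OF k] by simp
    then have "k \<bullet> k = 0"
      using cross_triple[of m k m'] cross_triple[of k m' m] cross_skew[of m' m]
      by (simp add: k_def inner_commute)
    then show False using k by simp
  qed
  then have "(m \<bullet> k) *\<^sub>R m - (m \<bullet> m) *\<^sub>R k = 0"
    using Lagrange[of m m k] by simp
  then show ?thesis by (auto simp: k_def dot_cross_self)
qed

lemma is_line_dual_line: "m \<noteq> 0 \<Longrightarrow> is_line (dual_line m)"
  unfolding is_line_def
  by (intro exI[of _ "{x. m \<bullet> x = 0}"]) (simp add: subspace_hyperplane dim_hyperplane)

lemma line_through_pt:
  assumes "x \<noteq> 0" "y \<noteq> 0"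
  shows "line_through (pt x) (pt y) = points_of (span {x, y})"
proof -
  have "span (span {x} \<union> span {y}) = span {x, y}"
    by (simp only: insert_is_Un[of x "{y}"] span_Un span_span)
  then show ?thesis unfolding line_through_def by (simp add: Rep_pt assms)
qed

lemma line_through_eq_dual_line:
  assumes "m \<noteq> 0" "m \<bullet> x = 0" "m \<bullet> y = 0" "x \<times> y \<noteq> 0"
  shows "line_through (pt x) (pt y) = dual_line m"
proof -
  have "x \<noteq> 0" "y \<noteq> 0" using assms(4) by auto
  then show ?thesis
    using orthogonal_complement_eq_span[OF assms] line_through_pt by metis
qed

lemma alignedI:
  assumes "m \<noteq> 0" "x \<noteq> 0" "y \<noteq> 0" "z \<noteq> 0" "m \<bullet> x = 0" "m \<bullet> y = 0" "m \<bullet> z = 0"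
  shows "aligned (pt x) (pt y) (pt z)"
  unfolding aligned_def
  by (intro exI[of _ "dual_line m"]) (simp add: assms is_line_dual_line pt_in_dual_line)

text \<open>If the triple product vanishes, some nonzero vector is orthogonal to all three: a cross product of
two of them, or, when they are all proportional, any vector orthogonal to the first.\<close>
lemma not_aligned_imp_triple_product:
  assumes "\<not> aligned (pt x) (pt y) (pt z)" "x \<noteq> 0" "y \<noteq> 0" "z \<noteq> 0"
  shows "(x \<times> y) \<bullet> z \<noteq> 0"
proof
  assume xyz: "(x \<times> y) \<bullet> z = 0"
  have "\<exists>m. m \<noteq> 0 \<and> m \<bullet> x = 0 \<and> m \<bullet> y = 0 \<and> m \<bullet> z = 0"
  proof (cases "x \<times> y = 0")
    case False
    then show ?thesis
      using xyz by (intro exI[of _ "x \<times> y"]) (simp add: dot_cross_self inner_commute)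
  next
    case True
    then obtain s where s: "y = s *\<^sub>R x" using cross_eq_0_imp_scaleR assms(2) by blast
    show ?thesis
    proof (cases "x \<times> z = 0")
      case False
      then show ?thesis
        using s by (intro exI[of _ "x \<times> z"]) (simp add: dot_cross_self inner_commute)
    next
      case True
      then obtain t where t: "z = t *\<^sub>R x" using cross_eq_0_imp_scaleR assms(2) by blast
      obtain m where "m \<noteq> 0" "m \<bullet> x = 0"
        using orthogonal_to_vector_exists[of x] by (auto simp: orthogonal_def inner_commute)
      then show ?thesis using s t by (intro exI[of _ m]) simp
    qed
  qed
  then show False using alignedI assms by metis
qed

section \<open>Oriented lines\<close>

text \<open>For a basis \<open>(u, v)\<close> of the plane orthogonal to \<open>m\<close>, the product \<open>u \<times> v\<close> is a positive or a negative
multiple of \<open>m\<close>.  So a normal vector, up to positive scaling, is the same as an oriented line.\<close>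
definition oriented_dual_line :: "real^3 \<Rightarrow> oriented_line" where
  "oriented_dual_line m = {(u, v). \<exists>t>0. u \<times> v = t *\<^sub>R m}"

lemma cross_cross_self:
  fixes m x :: "real^3"
  assumes "m \<bullet> x = 0"
  shows "x \<times> (m \<times> x) = (x \<bullet> x) *\<^sub>R m"
  using assms by (simp add: Lagrange inner_commute)

lemma is_oriented_line_dual:
  assumes "m \<noteq> 0"
  shows "is_oriented_line (oriented_dual_line m)"
proof -
  obtain u where u: "m \<bullet> u = 0" "u \<noteq> 0"
    using orthogonal_to_vector_exists[of m] by (auto simp: orthogonal_def)
  define v where "v = (1 / (u \<bullet> u)) *\<^sub>R (m \<times> u)"
  have uv: "u \<times> v = m"
    using cross_cross_self[OF u(1)] u by (simp add: v_def cross_mult_right)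
  have v: "m \<bullet> v = 0" by (simp add: v_def dot_cross_self)
  have sp: "{z. m \<bullet> z = 0} = span {u, v}"
    using orthogonal_complement_eq_span[OF assms u(1) v] uv assms by simp
  have "u \<noteq> v" using uv assms by auto
  moreover have "independent {u, v}"
  proof -
    have "u \<notin> span {v}"
      using uv assms by (auto simp: span_singleton cross_mult_left)
    moreover have "v \<noteq> 0" using uv assms by auto
    ultimately show ?thesis by (simp add: independent_insert)
  qed
  moreover have "oriented_dual_line m = positive_bases u v"
  proof -
    have cr: "(a *\<^sub>R u + b *\<^sub>R v) \<times> (c *\<^sub>R u + d *\<^sub>R v) = (a * d - b * c) *\<^sub>R m" for a b c d
      using uv cross_skew[of v u]
      by (simp add: cross_add_left cross_add_right cross_mult_left cross_mult_right algebra_simps)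
    have "\<exists>a b c d. p = a *\<^sub>R u + b *\<^sub>R v \<and> q = c *\<^sub>R u + d *\<^sub>R v \<and> a * d - b * c > 0"
      if "t > 0" "p \<times> q = t *\<^sub>R m" for p q t
    proof -
      have "t * (m \<bullet> p) = 0" "t * (m \<bullet> q) = 0"
        using that(2) dot_cross_self(1)[of p q] dot_cross_self(2)[of q p]
        by (auto simp: inner_commute)
      then have "p \<in> span {u, v}" "q \<in> span {u, v}" using that(1) sp by auto
      then obtain a b c d where *: "p = a *\<^sub>R u + b *\<^sub>R v" "q = c *\<^sub>R u + d *\<^sub>R v"
        by (auto simp: span_insert span_singleton algebra_simps)
      with that(2) cr have "(a * d - b * c) *\<^sub>R m = t *\<^sub>R m" by metis
      then have "a * d - b * c = t" using assms by simp
      with * that(1) show ?thesis by blast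
    qed
    then show ?thesis
      unfolding oriented_dual_line_def positive_bases_def using cr by blast
  qed
  ultimately show ?thesis unfolding is_oriented_line_def by blast
qed

lemma line_of_oriented_dual_line:
  assumes "m \<noteq> 0"
  shows "line_of (oriented_dual_line m) = dual_line m"
proof
  show "line_of (oriented_dual_line m) \<subseteq> dual_line m"
  proof
    fix p assume "p \<in> line_of (oriented_dual_line m)"
    then obtain u v t where p: "p = pt u" "t > 0" "u \<times> v = t *\<^sub>R m"
      unfolding line_of_def oriented_dual_line_def by auto
    then have "u \<noteq> 0" using assms by auto
    moreover have "t * (m \<bullet> u) = 0"
      using p dot_cross_self(1)[of u v] by (simp add: inner_commute)
    ultimately show "p \<in> dual_line m" using p pt_in_dual_line by simp
  qed
  show "dual_line m \<subseteq> line_of (oriented_dual_line m)"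
  proof
    fix p assume p: "p \<in> dual_line m"
    obtain u where u: "u \<noteq> 0" "p = pt u" using rp2_cases .
    then have "m \<bullet> u = 0" using p pt_in_dual_line by simp
    then have "(u, m \<times> u) \<in> oriented_dual_line m"
      using cross_cross_self[of m u] u(1) unfolding oriented_dual_line_def
      by (auto intro!: exI[of _ "u \<bullet> u"])
    then show "p \<in> line_of (oriented_dual_line m)" unfolding line_of_def using u by auto
  qed
qed

lemma oriented_dual_line_scaleR:
  assumes "s > 0"
  shows "oriented_dual_line (s *\<^sub>R m) = oriented_dual_line m"
proof -
  have "\<exists>t>0. w = t *\<^sub>R m" if "t > 0" "w = t *\<^sub>R s *\<^sub>R m" for w t
    using that assms by (intro exI[of _ "t * s"]) simp
  moreover have "\<exists>t>0. w = t *\<^sub>R s *\<^sub>R m" if "t > 0" "w = t *\<^sub>R m" for w t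
    using that assms by (intro exI[of _ "t / s"]) simp
  ultimately show ?thesis unfolding oriented_dual_line_def by blast
qed

section \<open>The reflection law on dual vectors\<close>

text \<open>The reflection law on signed normals of oriented lines, for a boundary with normal \<open>n\<close> whose
transverse lines pass through \<open>pt c\<close>.  It does not mention the point of reflection: the involution of
the pencil at any point of the boundary is induced by one map of the plane, the harmonic
homology with center \<open>pt c\<close> and axis \<open>dual_line n\<close>.  A homology of \<open>\<real>\<^sup>3\<close> has determinant \<open>- 1\<close>, so on
cross products it acts by minus its inverse transpose, which is this map.\<close>
definition dual_reflection :: "real^3 \<Rightarrow> real^3 \<Rightarrow> real^3 \<Rightarrow> real^3" where
  "dual_reflection n c m = (2 * (c \<bullet> m) / (n \<bullet> c)) *\<^sub>R n - m"

lemma linear_dual_reflection: "linear (dual_reflection n c)"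
  unfolding dual_reflection_def
  by (intro linearI) (simp_all add: inner_add_right algebra_simps add_divide_distrib)

lemma dual_reflection_center: "n \<bullet> c \<noteq> 0 \<Longrightarrow> c \<bullet> dual_reflection n c m = c \<bullet> m"
  by (simp add: dual_reflection_def inner_diff_right inner_commute)

lemma dual_reflection_boundary: "n \<bullet> x = 0 \<Longrightarrow> x \<bullet> dual_reflection n c m = - (x \<bullet> m)"
  by (simp add: dual_reflection_def inner_diff_right inner_commute)

lemma cross_dual_reflection: "n \<times> dual_reflection n c m = - (n \<times> m)"
  by (simp add: dual_reflection_def Cross3.right_diff_distrib cross_mult_right)

lemma dual_reflection_involution:
  "n \<bullet> c \<noteq> 0 \<Longrightarrow> dual_reflection n c (dual_reflection n c m) = m"
  using dual_reflection_center[of n c m] by (simp add: dual_reflection_def)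

text \<open>The linear reflection that fixes the plane orthogonal to \<open>n\<close> and sends \<open>c\<close> to \<open>- c\<close>.\<close>
definition harmonic_homology :: "real^3 \<Rightarrow> real^3 \<Rightarrow> real^3 \<Rightarrow> real^3" where
  "harmonic_homology n c x = x - (2 * (n \<bullet> x) / (n \<bullet> c)) *\<^sub>R c"

lemma linear_homology: "linear (harmonic_homology n c)"
  unfolding harmonic_homology_def
  by (intro linearI) (simp_all add: inner_add_right algebra_simps add_divide_distrib)

lemma homology_involution:
  assumes "n \<bullet> c \<noteq> 0" shows "harmonic_homology n c (harmonic_homology n c x) = x"
proof -
  have "n \<bullet> harmonic_homology n c x = - (n \<bullet> x)"
    using assms by (simp add: harmonic_homology_def inner_diff_right)
  then show ?thesis by (simp add: harmonic_homology_def)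
qed

lemma bij_homology: "n \<bullet> c \<noteq> 0 \<Longrightarrow> bij (harmonic_homology n c)"
  using homology_involution by (metis bijI')

text \<open>This adjunction is why the homology maps the line with normal \<open>m\<close> to the line with normal
\<open>dual_reflection n c m\<close>.\<close>
lemma inner_homology: "m \<bullet> harmonic_homology n c x = - (dual_reflection n c m \<bullet> x)"
  by (simp add: harmonic_homology_def dual_reflection_def inner_diff_right inner_diff_left inner_commute)

lemma proj_map_pt:
  assumes "linear T" "x \<noteq> 0"
  shows "proj_map T (pt x) = pt (T x)"
proof -
  have "T ` span {x} = span {T x}"
    using linear_span_image[OF assms(1), of "{x}"] by simp
  then show ?thesis by (simp add: proj_map_def Rep_pt assms) (simp add: pt_def)
qed

lemma homology_nonzero: "n \<bullet> c \<noteq> 0 \<Longrightarrow> x \<noteq> 0 \<Longrightarrow> harmonic_homology n c x \<noteq> 0"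
  using homology_involution[of n c x] linear_0[OF linear_homology, of n c] by metis

lemma proj_homology_involution:
  assumes "n \<bullet> c \<noteq> 0"
  shows "proj_map (harmonic_homology n c) (proj_map (harmonic_homology n c) p) = p"
proof -
  obtain x where "x \<noteq> 0" "p = pt x" using rp2_cases .
  then show ?thesis
    using assms by (simp add: proj_map_pt linear_homology homology_nonzero homology_involution)
qed

lemma homology_dual_line:
  assumes "n \<bullet> c \<noteq> 0"
  shows "proj_map (harmonic_homology n c) ` dual_line m = dual_line (dual_reflection n c m)"
proof -
  have sub: "proj_map (harmonic_homology n c) p \<in> dual_line (dual_reflection n c m)"
    if "p \<in> dual_line m" for m p
  proof -
    obtain x where x: "x \<noteq> 0" "p = pt x" using rp2_cases .
    then have "m \<bullet> x = 0" using that pt_in_dual_line by simp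
    then have "dual_reflection n c m \<bullet> harmonic_homology n c x = 0"
      by (simp add: inner_homology dual_reflection_involution assms)
    then show ?thesis
      using x assms
      by (simp add: proj_map_pt linear_homology pt_in_dual_line homology_nonzero)
  qed
  show ?thesis
  proof
    show "proj_map (harmonic_homology n c) ` dual_line m \<subseteq> dual_line (dual_reflection n c m)"
      using sub by blast
    show "dual_line (dual_reflection n c m) \<subseteq> proj_map (harmonic_homology n c) ` dual_line m"
    proof
      fix p assume "p \<in> dual_line (dual_reflection n c m)"
      then have "proj_map (harmonic_homology n c) p \<in> dual_line m"
        using sub dual_reflection_involution assms by metis
      then show "p \<in> proj_map (harmonic_homology n c) ` dual_line m"
        using proj_homology_involution[OF assms] by (metis image_eqI)
    qed
  qed
qed

text \<open>Only \<open>dual_line n\<close> and the line to the center are fixed in the pencil at \<open>pt w\<close>.  Their normals are \<open>n\<close>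
and \<open>c \<times> w\<close>, and the dual reflection fixes the first and negates the second, so it moves the line with
normal \<open>n + c \<times> w\<close>.\<close>
lemma homology_moves_line:
  assumes nc: "n \<bullet> c \<noteq> 0" and w: "w \<noteq> 0" "n \<bullet> w = 0"
  obtains l where "l \<in> pencil (pt w)" "proj_map (harmonic_homology n c) ` l \<noteq> l"
proof -
  define q where "q = c \<times> w"
  have "n \<times> q = - ((n \<bullet> c) *\<^sub>R w)" using w by (simp add: q_def Lagrange)
  then have nq: "n \<times> q \<noteq> 0" using nc w by simp
  have cq: "c \<bullet> q = 0" "w \<bullet> q = 0" by (simp_all add: q_def dot_cross_self)
  have "n + q \<noteq> 0"
  proof
    assume "n + q = 0"
    then have "q = - n" by (metis add.commute eq_neg_iff_add_eq_0)
    then show False using nq by simp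
  qed
  then have "dual_line (n + q) \<in> pencil (pt w)"
    using w cq(2) is_line_dual_line[of "n + q"] pt_in_dual_line[of w "n + q"]
    by (simp add: pencil_def inner_add_left inner_commute[of q w])
  moreover have "dual_reflection n c (n + q) = n - q"
    using nc cq by (simp add: dual_reflection_def inner_add_right inner_commute algebra_simps scaleR_2)
  then have "proj_map (harmonic_homology n c) ` dual_line (n + q) = dual_line (n - q)"
    using homology_dual_line[OF nc] by metis
  moreover have "dual_line (n - q) \<noteq> dual_line (n + q)"
  proof
    assume "dual_line (n - q) = dual_line (n + q)"
    then have "(n - q) \<times> (n + q) = 0" by (rule dual_line_eqD)
    moreover have "(n - q) \<times> (n + q) = 2 *\<^sub>R (n \<times> q)"
      using cross_skew[of q n]
      by (simp add: cross_add_right Cross3.left_diff_distrib scaleR_2)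
    ultimately show False using nq by simp
  qed
  ultimately show ?thesis using that by metis
qed

text \<open>The harmonic homology supplies the involution.  For the orientations, \<open>(w, m \<times> w)\<close> is a positive basis
of the line with normal \<open>m\<close>, where \<open>w = n \<times> m\<close> spans the point of reflection, and \<open>n \<bullet> (m \<times> w)\<close> equals
\<open>(n \<times> m) \<bullet> w\<close>.  As \<open>n \<times> m\<close> changes sign under the dual reflection, the two oriented lines cross the
boundary in opposite directions.\<close>
lemma reflection_law_dual:
  assumes nc: "n \<bullet> c \<noteq> 0" and nm: "n \<times> m \<noteq> 0"
  shows "reflection_law (pt (n \<times> m)) (line_through (pt (n \<times> m)) (pt c)) (dual_line n)
           (oriented_dual_line m) (oriented_dual_line (dual_reflection n c m))"
proof -
  define w where "w = n \<times> m"
  define m' where "m' = dual_reflection n c m"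
  define f where "f = (\<lambda>l. proj_map (harmonic_homology n c) ` l)"
  have w: "w \<noteq> 0" "n \<bullet> w = 0" "m \<bullet> w = 0"
    using nm by (simp_all add: w_def dot_cross_self)
  have m': "n \<times> m' = - w" by (simp add: m'_def w_def cross_dual_reflection)
  have m0: "m \<noteq> 0" using nm by auto
  have m'0: "m' \<noteq> 0" using m' w by auto
  have m'w: "m' \<bullet> w = 0"
    using dot_cross_self(2)[of m' n] m' by simp
  have n0: "n \<noteq> 0" using nc by auto
  have wc: "w \<times> c \<noteq> 0"
  proof
    assume "w \<times> c = 0"
    then obtain s where "c = s *\<^sub>R w" using cross_eq_0_imp_scaleR w by blast
    then show False using nc w by simp
  qed
  have L: "line_through (pt w) (pt c) = dual_line (w \<times> c)"
    by (rule line_through_eq_dual_line) (use wc in \<open>auto simp: dot_cross_self\<close>)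
  have pen: "dual_line k \<in> pencil (pt w)" if "k \<noteq> 0" "k \<bullet> w = 0" for k
    using that w by (simp add: pencil_def is_line_dual_line pt_in_dual_line)
  have f: "f (dual_line k) = dual_line (dual_reflection n c k)" for k
    unfolding f_def by (rule homology_dual_line[OF nc])
  have fix_w: "harmonic_homology n c w = w" using w by (simp add: harmonic_homology_def)
  have ff: "f (f l) = l" for l
    unfolding f_def by (simp add: image_image proj_homology_involution[OF nc])
  have "nontrivial_pencil_involution (pt w) f"
    unfolding nontrivial_pencil_involution_def
  proof (intro conjI ballI)
    show "pencil_projective (pt w) f"
      unfolding pencil_projective_def f_def
      by (intro exI[of _ "harmonic_homology n c"])
        (simp add: linear_homology bij_homology nc proj_map_pt w fix_w)
    show "\<exists>l\<in>pencil (pt w). f l \<noteq> l"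
      using homology_moves_line[OF nc w(1,2)] unfolding f_def by metis
  qed (rule ff)
  moreover have "f (dual_line (w \<times> c)) = dual_line (w \<times> c)"
    unfolding f by (simp add: dual_reflection_def dot_cross_self)
  moreover have "f (dual_line n) = dual_line n"
  proof -
    have "dual_reflection n c n = n"
      using nc by (simp add: dual_reflection_def inner_commute scaleR_2)
    then show ?thesis by (simp add: f)
  qed
  moreover have fm: "f (dual_line m) = dual_line m'" by (simp add: f m'_def)
  moreover have "f (dual_line m') = dual_line m" using ff fm by metis
  ultimately have "harmonic_lines (pt w) (dual_line m) (dual_line m') (dual_line (w \<times> c)) (dual_line n)"
    unfolding harmonic_lines_def
    using pen[of m] pen[of m'] pen[of n] pen[of "w \<times> c"] m0 m'0 n0 wc w m'w
    by (auto simp: dot_cross_self)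
  moreover have "opposite_orientations (pt w) (dual_line n) (oriented_dual_line m) (oriented_dual_line m')"
    unfolding opposite_orientations_def
  proof (intro exI conjI)
    show "(w, m \<times> w) \<in> oriented_dual_line m"
      unfolding oriented_dual_line_def using cross_cross_self[OF w(3)] w(1)
      by (auto intro!: exI[of _ "w \<bullet> w"])
    show "(w, m' \<times> w) \<in> oriented_dual_line m'"
      unfolding oriented_dual_line_def using cross_cross_self[OF m'w] w(1)
      by (auto intro!: exI[of _ "w \<bullet> w"])
    have "n \<bullet> (m \<times> w) = w \<bullet> w" "n \<bullet> (m' \<times> w) = - (w \<bullet> w)"
      using cross_triple[of n m w] cross_triple[of n m' w] m'
      by (simp_all add: w_def inner_commute)
    then show "(n \<bullet> (m \<times> w)) * (n \<bullet> (m' \<times> w)) < 0" using w by simp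
  qed (use w in auto)
  ultimately show ?thesis
    unfolding reflection_law_def
    using m0 m'0 L by (simp add: line_of_oriented_dual_line w_def m'_def)
qed

section \<open>Periodic orbits from sequences of dual vectors\<close>

text \<open>Here \<open>m j\<close> is the signed normal of the segment from the \<open>j\<close>th to the next point.  The transversality
assumption says that no segment passes through the intersection of the two boundaries that it
joins; this gives at once that consecutive points differ and that segments are transverse to the
boundaries.  The sign assumption makes the orientation a function of the two end points: when a
segment occurs again, its normal is a positive multiple of the previous one.\<close>
lemma periodic_orbit_of_normals:
  fixes n c m :: "nat \<Rightarrow> real^3"
  defines "p \<equiv> \<lambda>j. pt (n j \<times> m j)"
  assumes len: "length B dvd k" "2 \<le> k"
    and boundary: "\<And>j. boundary B j = dual_line (n j)"
    and field: "\<And>j q. transverse_field B j q = line_through q (pt (c j))"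
    and nc: "\<And>j. n j \<bullet> c j \<noteq> 0"
    and step: "\<And>j. m (Suc j) = dual_reflection (n (Suc j)) (c (Suc j)) (m j)"
    and per: "\<And>j. n (j + k) = n j" "\<And>j. m (j + k) = m j"
    and transverse: "\<And>j. m j \<bullet> (n j \<times> n (Suc j)) \<noteq> 0"
    and sign: "\<And>i j s. m i = s *\<^sub>R m j \<Longrightarrow> s > 0"
  shows "periodic_orbit B k (map p [0..<k])"
proof -
  define \<omega> where "\<omega> = (\<lambda>q r. oriented_dual_line (m (SOME j. q = p j \<and> r = p (Suc j))))"
  have m0: "m j \<noteq> 0" for j using transverse[of j] by auto
  have nm: "n j \<times> m j \<noteq> 0" for j
  proof
    assume "n j \<times> m j = 0"
    moreover have "m j \<bullet> (n j \<times> n (Suc j)) = - ((n j \<times> m j) \<bullet> n (Suc j))"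
      by (simp add: cross3_simps)
    ultimately show False using transverse[of j] by simp
  qed
  have pSuc: "p (Suc j) = pt (n (Suc j) \<times> m j)" for j
  proof -
    have "n (Suc j) \<times> m (Suc j) = - (n (Suc j) \<times> m j)"
      by (simp add: step cross_dual_reflection)
    then show ?thesis by (simp add: p_def pt_minus)
  qed
  \<comment> \<open>The two end points of a segment, as vectors, span its plane.\<close>
  have cr: "(n j \<times> m j) \<times> (n (Suc j) \<times> m j) \<noteq> 0" for j
  proof -
    have "(n j \<times> m j) \<bullet> n (Suc j) = - (m j \<bullet> (n j \<times> n (Suc j)))"
      by (simp add: cross3_simps)
    then have "(n j \<times> m j) \<times> (n (Suc j) \<times> m j) = (m j \<bullet> (n j \<times> n (Suc j))) *\<^sub>R m j"
      by (simp add: Lagrange dot_cross_self)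
    then show ?thesis using transverse[of j] m0[of j] by simp
  qed
  have ne: "p j \<noteq> p (Suc j)" for j
  proof -
    have "n j \<times> m j \<noteq> 0" "n (Suc j) \<times> m j \<noteq> 0" using cr[of j] by auto
    then show ?thesis
      using cr[of j] unfolding pSuc unfolding p_def by (simp add: pt_eq_iff)
  qed
  have line: "line_through (p j) (p (Suc j)) = dual_line (m j)" for j
    unfolding pSuc unfolding p_def
    by (rule line_through_eq_dual_line[OF m0]) (simp_all add: dot_cross_self cr)
  have \<omega>: "\<omega> (p j) (p (Suc j)) = oriented_dual_line (m j)" for j
  proof -
    define i where "i = (SOME i. p j = p i \<and> p (Suc j) = p (Suc i))"
    have "p j = p i \<and> p (Suc j) = p (Suc i)"
      unfolding i_def by (rule someI[of _ j]) simp
    then have "dual_line (m j) = dual_line (m i)" using line by metis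
    then have "m j \<times> m i = 0" by (rule dual_line_eqD)
    then obtain s where s: "m i = s *\<^sub>R m j" using cross_eq_0_imp_scaleR m0 by blast
    then have "oriented_dual_line (m i) = oriented_dual_line (m j)"
      using oriented_dual_line_scaleR[OF sign[OF s]] by simp
    then show ?thesis unfolding \<omega>_def i_def .
  qed
  have tr: "dual_line (m j) \<noteq> dual_line (n j)" "dual_line (m j) \<noteq> dual_line (n (Suc j))" for j
  proof -
    have *: "m j \<bullet> (n j \<times> n (Suc j)) = (m j \<times> n j) \<bullet> n (Suc j)"
       "m j \<bullet> (n j \<times> n (Suc j)) = - ((m j \<times> n (Suc j)) \<bullet> n j)"
      by (simp_all add: cross3_simps)
    show "dual_line (m j) \<noteq> dual_line (n j)"
      using dual_line_eqD[of "m j" "n j"] transverse[of j] *(1) by auto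
    show "dual_line (m j) \<noteq> dual_line (n (Suc j))"
      using dual_line_eqD[of "m j" "n (Suc j)"] transverse[of j] *(2) by auto
  qed
  have refl: "reflection_law (p (Suc j)) (line_through (p (Suc j)) (pt (c (Suc j)))) (dual_line (n (Suc j)))
      (oriented_dual_line (m j)) (oriented_dual_line (m (Suc j)))" for j
    unfolding pSuc step
    by (rule reflection_law_dual[OF nc]) (use cr[of j] in auto)
  have pk: "p k = p 0" "p (Suc k) = p (Suc 0)"
    using per(1)[of 0] per(2)[of 0] per(1)[of "Suc 0"] per(2)[of "Suc 0"] by (simp_all add: p_def)
  define q where "q = map p [0..<k + 2]"
  have lenq: "length q = k + 2" and q: "j < k + 2 \<Longrightarrow> q ! j = p j" for j
    by (simp_all add: q_def del: upt_Suc)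
  have on: "p j \<in> dual_line (n j)" for j
    using nm[of j] by (simp add: p_def pt_in_dual_line dot_cross_self)
  have "map p [0..<k] @ [map p [0..<k] ! 0, map p [0..<k] ! 1] = q"
    using pk len(2) by (simp add: q_def)
  moreover have "orbit B q"
    unfolding orbit_def lenq
    by (intro conjI exI[of _ \<omega>] allI impI)
      (simp_all add: q on boundary ne \<omega> is_oriented_line_dual m0 line_of_oriented_dual_line line
        tr field refl)
  ultimately show ?thesis
    unfolding periodic_orbit_def using len by simp
qed

section \<open>Generic initial segments\<close>

text \<open>A finite union of hyperplanes has measure zero.\<close>
lemma exists_nonorthogonal:
  fixes D :: "'a::euclidean_space set"
  assumes "finite D" "0 \<notin> D"
  shows "\<exists>m. \<forall>d\<in>D. d \<bullet> m \<noteq> 0"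
proof -
  have "negligible (\<Union>d\<in>D. {m. d \<bullet> m = 0})"
    using assms by (auto intro!: negligible_Union negligible_hyperplane)
  then have "(\<Union>d\<in>D. {m. d \<bullet> m = 0}) \<noteq> UNIV"
    using non_negligible_UNIV by metis
  then show ?thesis by auto
qed

text \<open>The cone over an open set is open.\<close>
lemma open_pt_image:
  assumes "open A"
  shows "open (pt ` (A - {0}))"
proof -
  have "{v. v \<noteq> 0 \<and> pt v \<in> pt ` (A - {0})} = (\<Union>s\<in>- {0}. (*\<^sub>R) s ` (A - {0}))"
  proof (intro equalityI subsetI)
    fix v assume "v \<in> {v. v \<noteq> 0 \<and> pt v \<in> pt ` (A - {0})}"
    then obtain a where a: "v \<noteq> 0" "a \<in> A - {0}" "pt v = pt a" by auto
    then have "a \<times> v = 0" using pt_eq_iff by force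
    then obtain s where s: "v = s *\<^sub>R a" using cross_eq_0_imp_scaleR a(2) by blast
    then have "s \<noteq> 0" using a by auto
    then show "v \<in> (\<Union>s\<in>- {0}. (*\<^sub>R) s ` (A - {0}))" using s a by blast
  qed (auto simp: pt_scaleR)
  moreover have "open (\<Union>s\<in>- {0}. (*\<^sub>R) s ` (A - {0}))"
    using assms by (intro open_UN ballI open_scaling) (auto intro: open_delete)
  ultimately show ?thesis by (simp add: open_rp2_def)
qed

text \<open>Joining points \<open>pt x1\<close>, \<open>pt x2\<close> of two different lines gives the normal \<open>x1 \<times> x2\<close>, and a normal outside
finitely many given planes through the origin occurs for some pair.  By continuity this remains so
for all pairs in a product of neighbourhoods.\<close>
lemma generic_segments:
  fixes n0 n1 :: "real^3"
  assumes n: "n0 \<times> n1 \<noteq> 0" and D: "finite D" "0 \<notin> D"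
  obtains U1 U2 where "U1 \<noteq> {}" "U2 \<noteq> {}"
    "openin (top_of_set (dual_line n0)) U1" "openin (top_of_set (dual_line n1)) U2"
    "\<And>p1 p2. p1 \<in> U1 \<Longrightarrow> p2 \<in> U2 \<Longrightarrow>
       \<exists>m. p1 = pt (n0 \<times> m) \<and> p2 = pt (n1 \<times> m) \<and> (\<forall>d\<in>D. d \<bullet> m \<noteq> 0)"
proof -
  \<comment> \<open>Lines through the common point of the two boundaries are excluded too:
    they do not meet the boundaries in a pair of distinct points.\<close>
  define E where "E = insert (n0 \<times> n1) D"
  have E: "finite E" "0 \<notin> E" using n D by (auto simp: E_def)
  obtain m where m: "\<And>d. d \<in> E \<Longrightarrow> d \<bullet> m \<noteq> 0"
    using exists_nonorthogonal[OF E] by blast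
  define G where "G = (\<Inter>d\<in>E. {z. d \<bullet> (fst z \<times> snd z) \<noteq> 0})"
  have "open G"
    unfolding G_def
    by (intro open_INT ballI E(1) open_Collect_neq continuous_intros continuous_on_cross)
  have cr: "(n0 \<times> m) \<times> (n1 \<times> m) = ((n0 \<times> n1) \<bullet> m) *\<^sub>R m"
  proof -
    have "(n0 \<times> m) \<bullet> n1 = - ((n0 \<times> n1) \<bullet> m)" by (simp add: cross3_simps)
    then show ?thesis by (simp add: Lagrange dot_cross_self)
  qed
  then have "(n0 \<times> m, n1 \<times> m) \<in> G"
    using m by (auto simp: G_def E_def)
  then obtain A1 A2 where A: "open A1" "open A2" "n0 \<times> m \<in> A1" "n1 \<times> m \<in> A2"
    "Product_Type.Times A1 A2 \<subseteq> G"
    using \<open>open G\<close> unfolding open_prod_def by fast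
  define U where "U = (\<lambda>n A. dual_line n \<inter> pt ` (A - {0}))"
  have U: "x \<in> A \<Longrightarrow> x \<noteq> 0 \<Longrightarrow> n \<bullet> x = 0 \<Longrightarrow> U n A \<noteq> {}" for x n A
    unfolding U_def using pt_in_dual_line by blast
  have UD: "\<exists>x\<in>A. x \<noteq> 0 \<and> p = pt x \<and> n \<bullet> x = 0" if "p \<in> U n A" for p n A
    using that unfolding U_def by (auto simp: pt_in_dual_line intro!: bexI)
  have nz: "n0 \<times> m \<noteq> 0" "n1 \<times> m \<noteq> 0"
    using cr m[of "n0 \<times> n1"] by (auto simp: E_def)
  show ?thesis
  proof (rule that[of "U n0 A1" "U n1 A2"])
    show "U n0 A1 \<noteq> {}" "U n1 A2 \<noteq> {}"
      using U[OF A(3)] U[OF A(4)] nz by (simp_all add: dot_cross_self)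
    show "openin (top_of_set (dual_line n0)) (U n0 A1)" "openin (top_of_set (dual_line n1)) (U n1 A2)"
      unfolding U_def using A(1,2) open_pt_image by blast+
  next
    fix p1 p2 assume "p1 \<in> U n0 A1" "p2 \<in> U n1 A2"
    then obtain x1 x2 where x: "x1 \<in> A1" "x1 \<noteq> 0" "p1 = pt x1" "n0 \<bullet> x1 = 0"
      "x2 \<in> A2" "x2 \<noteq> 0" "p2 = pt x2" "n1 \<bullet> x2 = 0"
      using UD by metis
    define k where "k = x1 \<times> x2"
    have k: "d \<bullet> k \<noteq> 0" if "d \<in> E" for d
      using A(5) x(1,5) that by (auto simp: G_def k_def)
    \<comment> \<open>Intersecting the joining line with the two boundaries recovers the two points.\<close>
    have "n0 \<times> k = (n0 \<bullet> x2) *\<^sub>R x1" "n1 \<times> k = - (n1 \<bullet> x1) *\<^sub>R x2"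
      using x by (simp_all add: k_def Lagrange)
    moreover have "(n0 \<times> n1) \<bullet> k = - ((n0 \<bullet> x2) * (n1 \<bullet> x1))"
      using x by (simp add: k_def dot_cross)
    then have "n0 \<bullet> x2 \<noteq> 0" "n1 \<bullet> x1 \<noteq> 0"
      using k[of "n0 \<times> n1"] by (auto simp: E_def)
    ultimately have "p1 = pt (n0 \<times> k)" "p2 = pt (n1 \<times> k)"
      using x pt_scaleR[of "n0 \<bullet> x2" x1] pt_scaleR[of "- (n1 \<bullet> x1)" x2] by auto
    then show "\<exists>m. p1 = pt (n0 \<times> m) \<and> p2 = pt (n1 \<times> m) \<and> (\<forall>d\<in>D. d \<bullet> m \<noteq> 0)"
      using k by (auto simp: E_def)
  qed
qed

section \<open>Trajectories\<close>

primrec trajectory :: "(nat \<Rightarrow> real^3) \<Rightarrow> (nat \<Rightarrow> real^3) \<Rightarrow> real^3 \<Rightarrow> nat \<Rightarrow> real^3" where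
  "trajectory n c m 0 = m"
| "trajectory n c m (Suc j) = dual_reflection (n (Suc j)) (c (Suc j)) (trajectory n c m j)"

lemma linear_trajectory: "linear (\<lambda>m. trajectory n c m j)"
proof (induction j)
  case (Suc j)
  then show ?case
    using linear_compose[OF Suc linear_dual_reflection] by (simp add: o_def)
qed (simp add: linear_id[unfolded id_def])

text \<open>Each reflection is an involution, hence onto.\<close>
lemma surj_trajectory:
  assumes "\<And>j. n j \<bullet> c j \<noteq> 0"
  shows "\<exists>m. trajectory n c m j = e"
proof (induction j arbitrary: e)
  case (Suc j)
  obtain m where "trajectory n c m j = dual_reflection (n (Suc j)) (c (Suc j)) e"
    using Suc by blast
  then show ?case
    using dual_reflection_involution[OF assms] by (intro exI[of _ m]) simp
qed simp

text \<open>If the composition of the reflections along one period is the identity on signed normals, then the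
trajectory of every generic initial segment closes up.  Genericity means that finitely many linear
forms in the initial normal do not vanish: the transversality condition at the \<open>j\<close>th step is pulled
back along the linear map \<open>trajectory n c _ j\<close>.  The product over \<open>V\<close> provides the orientations: it is constant
along a trajectory and, being homogeneous of odd degree, it tells a normal from its negative.\<close>
theorem reflective_of_closed_trajectories:
  fixes n c :: "nat \<Rightarrow> real^3"
  assumes len: "length B dvd k" "2 \<le> k"
    and boundary: "\<And>j. boundary B j = dual_line (n j)"
    and field: "\<And>j q. transverse_field B j q = line_through q (pt (c j))"
    and nc: "\<And>j. n j \<bullet> c j \<noteq> 0"
    and per: "\<And>j. n (j + k) = n j" "\<And>j. c (j + k) = c j"
    and consecutive: "\<And>j. n j \<times> n (Suc j) \<noteq> 0"
    and V: "finite V" "odd (card V)" "0 \<notin> V"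
    and invariant: "\<And>j m. (\<Prod>v\<in>V. v \<bullet> dual_reflection (n j) (c j) m) = (\<Prod>v\<in>V. v \<bullet> m)"
    and closed: "\<And>m. trajectory n c m k = m"
  shows "reflective k B"
proof -
  let ?T = "\<lambda>m j. trajectory n c m j"
  let ?F = "\<lambda>m. \<Prod>v\<in>V. v \<bullet> m"
  define g where "g = (\<lambda>j. adjoint (\<lambda>m. ?T m j) (n j \<times> n (Suc j)))"
  have g: "g j \<bullet> m = ?T m j \<bullet> (n j \<times> n (Suc j))" for j m
    using adjoint_works[OF linear_trajectory, of m n c j "n j \<times> n (Suc j)"]
    by (simp add: g_def inner_commute)
  have g0: "g j \<noteq> 0" for j
  proof
    assume "g j = 0"
    moreover obtain m where "?T m j = n j \<times> n (Suc j)"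
      using surj_trajectory[of n c j, OF nc] by blast
    ultimately show False using g[of j m] consecutive[of j] by simp
  qed
  have Tper: "?T m (j + k) = ?T m j" for m j
    by (induction j) (simp_all add: closed, metis add_Suc per)
  have F_scale: "?F (s *\<^sub>R m) = s ^ card V * ?F m" for s m
    by (simp add: prod.distrib)
  define D where "D = V \<union> g ` {..<k}"
  have D: "finite D" "0 \<notin> D" using V g0 by (auto simp: D_def)
  obtain U1 U2 where U: "U1 \<noteq> {}" "U2 \<noteq> {}"
    "openin (top_of_set (dual_line (n 0))) U1" "openin (top_of_set (dual_line (n (Suc 0)))) U2"
    "\<And>p1 p2. p1 \<in> U1 \<Longrightarrow> p2 \<in> U2 \<Longrightarrow>
       \<exists>m. p1 = pt (n 0 \<times> m) \<and> p2 = pt (n (Suc 0) \<times> m) \<and> (\<forall>d\<in>D. d \<bullet> m \<noteq> 0)"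
    using generic_segments[OF consecutive D] by metis
  have "\<exists>ps. periodic_orbit B k ps \<and> ps ! 0 = p1 \<and> ps ! 1 = p2"
    if p12: "p1 \<in> U1" "p2 \<in> U2" for p1 p2
  proof -
    obtain m0 where m0: "p1 = pt (n 0 \<times> m0)" "p2 = pt (n (Suc 0) \<times> m0)" "\<And>d. d \<in> D \<Longrightarrow> d \<bullet> m0 \<noteq> 0"
      using U(5)[OF p12] by blast
    \<comment> \<open>Of the two orientations of the initial segment, take the one with positive invariant.\<close>
    define m where "m = (if ?F m0 > 0 then m0 else - m0)"
    have "?F m0 \<noteq> 0" using m0(3) V(1) by (auto simp: D_def)
    then have F0: "?F m > 0"
      using F_scale[of "- 1" m0] V(2) by (auto simp: m_def)
    have m: "p1 = pt (n 0 \<times> m)" "p2 = pt (n (Suc 0) \<times> m)" "\<And>d. d \<in> D \<Longrightarrow> d \<bullet> m \<noteq> 0"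
      using m0 by (auto simp: m_def pt_minus)
    have F: "?F (?T m j) > 0" for j
      by (induction j) (simp_all add: F0 invariant)
    have "periodic_orbit B k (map (\<lambda>j. pt (n j \<times> ?T m j)) [0..<k])"
    proof (rule periodic_orbit_of_normals[OF len boundary field nc])
      fix j
      show "?T m (Suc j) = dual_reflection (n (Suc j)) (c (Suc j)) (?T m j)" by simp
      show "n (j + k) = n j" "?T m (j + k) = ?T m j" by (simp_all add: per Tper)
      have red: "n (j + i * k) = n j \<and> ?T m (j + i * k) = ?T m j" for i j
      proof (induction i)
        case (Suc i)
        then show ?case using per(1)[of "j + i * k"] Tper[of m "j + i * k"]
          by (simp add: algebra_simps)
      qed simp
      define r where "r = j mod k"
      have j: "j = r + (j div k) * k" by (simp add: r_def)
      have "n j = n r" "?T m j = ?T m r" using red[of r "j div k"] j by metis+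
      moreover have "n (Suc j) = n (Suc r)" using red[of "Suc r" "j div k"] j by (metis add_Suc)
      moreover have "g r \<bullet> m \<noteq> 0" using m(3)[of "g r"] len(2) by (simp add: D_def r_def)
      ultimately show "?T m j \<bullet> (n j \<times> n (Suc j)) \<noteq> 0" using g[of r m] by simp
    next
      fix i j s assume s: "?T m i = s *\<^sub>R ?T m j"
      have "0 < s ^ card V * ?F (?T m j)"
        using F[of i] unfolding s F_scale .
      then have "0 < s ^ card V" using F[of j] by (simp add: zero_less_mult_iff)
      then show "s > 0" using V(2) by (auto simp: zero_less_power_eq)
    qed
    moreover have "pt (n (Suc 0) \<times> ?T m (Suc 0)) = p2"
      by (simp add: cross_dual_reflection pt_minus m(2))
    ultimately show ?thesis
      using len(2) m(1) by (intro exI conjI) (assumption, simp_all)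
  qed
  then show ?thesis
    unfolding reflective_def using U by (intro exI[of _ U1] exI[of _ U2]) (simp add: boundary)
qed

section \<open>Right-spherical billiards\<close>

lemma eq_0_if_orthogonal_to_basis:
  fixes x y z w :: "real^3"
  assumes "(x \<times> y) \<bullet> z \<noteq> 0" "w \<bullet> x = 0" "w \<bullet> y = 0" "w \<bullet> z = 0"
  shows "w = 0"
proof -
  have "(x \<times> y) \<times> w = 0"
    using assms cross_skew[of "x \<times> y" w] by (simp add: Lagrange)
  moreover have "x \<times> y \<noteq> 0" using assms(1) by auto
  ultimately obtain s where "w = s *\<^sub>R (x \<times> y)" using cross_eq_0_imp_scaleR by blast
  then show ?thesis using assms by simp
qed

text \<open>In terms of the coordinates \<open>m \<bullet> x\<close>, \<open>m \<bullet> y\<close>, \<open>m \<bullet> z\<close> of a normal, the reflection in a side changes the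
signs of the coordinates at its two end points and keeps the third one.  After the three reflections
each sign has changed twice, and the product of the coordinates never changes.\<close>
theorem reflective_right_spherical:
  assumes "\<not> aligned P1 P2 P3"
  shows "reflective 3 (right_spherical P1 P2 P3)"
proof -
  obtain x y z where xyz: "x \<noteq> 0" "y \<noteq> 0" "z \<noteq> 0" "P1 = pt x" "P2 = pt y" "P3 = pt z"
    by (metis rp2_cases)
  define \<delta> where "\<delta> = (x \<times> y) \<bullet> z"
  have \<delta>: "\<delta> \<noteq> 0" using not_aligned_imp_triple_product assms xyz by (simp add: \<delta>_def)
  define X where "X = (\<lambda>j::nat. if j mod 3 = 0 then x else if j mod 3 = 1 then y else z)"
  define n where "n = (\<lambda>j. X j \<times> X (Suc j))"
  define c where "c = (\<lambda>j. X (Suc (Suc j)))"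
  let ?B = "right_spherical P1 P2 P3"
  have X3: "X (j + 3) = X j" for j by (simp add: X_def)
  have m3: "j mod 3 = 0 \<or> j mod 3 = 1 \<or> j mod 3 = 2" for j :: nat by linarith
  have "(y \<times> z) \<bullet> x = \<delta>" "(z \<times> x) \<bullet> y = \<delta>" by (simp_all add: \<delta>_def cross3_simps)
  then have nc: "n j \<bullet> c j = \<delta>" for j
    using m3[of j] by (elim disjE) (simp_all add: n_def c_def X_def mod_Suc \<delta>_def)
  have V: "{x, y, z} = {X j, X (Suc j), c j}" for j
    using m3[of j] by (elim disjE) (simp_all add: c_def X_def mod_Suc insert_commute)
  have nX: "n j \<bullet> X j = 0" "n j \<bullet> X (Suc j) = 0" for j
    by (simp_all add: n_def dot_cross_self)
  have "distinct [x, y, z]" using \<delta> by (auto simp: \<delta>_def dot_cross_self)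
  then have dist: "distinct [X j, X (Suc j), c j]" for j
    using m3[of j] by (auto simp: c_def X_def mod_Suc)
  have line: "line_through (pt (X j)) (pt (X (Suc j))) = dual_line (n j)" for j
  proof (rule line_through_eq_dual_line[OF _ nX])
    show "n j \<noteq> 0" using nc[of j] \<delta> by auto
    then show "X j \<times> X (Suc j) \<noteq> 0" unfolding n_def .
  qed
  have B: "?B ! (j mod length ?B) = (dual_line (n j), \<lambda>q. line_through q (pt (c j)))" for j
  proof -
    have "length ?B = 3" by (simp add: right_spherical_def)
    moreover have "?B ! (j mod 3)
        = (line_through (pt (X j)) (pt (X (Suc j))), \<lambda>q. line_through q (pt (c j)))"
      using m3[of j]
      by (elim disjE) (simp_all add: right_spherical_def framed_def xyz c_def X_def mod_Suc)
    ultimately show ?thesis using line[of j] by simp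
  qed
  show ?thesis
  proof (rule reflective_of_closed_trajectories[where n = n and c = c and V = "{x, y, z}"])
    show "length ?B dvd 3" by (simp add: right_spherical_def numeral_3_eq_3)
    show "boundary ?B j = dual_line (n j)" for j by (simp add: boundary_def B)
    show "transverse_field ?B j q = line_through q (pt (c j))" for j q
      by (simp add: transverse_field_def B)
    show "n j \<bullet> c j \<noteq> 0" for j using nc \<delta> by simp
    show "n (j + 3) = n j" "c (j + 3) = c j" for j
      using X3[of j] X3[of "Suc j"] X3[of "Suc (Suc j)"] by (simp_all add: n_def c_def)
    show "n j \<times> n (Suc j) \<noteq> 0" for j
    proof -
      have "n j \<times> n (Suc j) = \<delta> *\<^sub>R X (Suc j)"
      proof -
        have "n (Suc j) = X (Suc j) \<times> c j" by (simp add: n_def c_def)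
        then show ?thesis using nX[of j] nc[of j] by (simp add: Lagrange)
      qed
      moreover have "X (Suc j) \<noteq> 0" using xyz by (simp add: X_def)
      ultimately show ?thesis using \<delta> by simp
    qed
    show "finite {x, y, z}" by simp
    show "odd (card {x, y, z})" using \<open>distinct [x, y, z]\<close> by simp
    show "0 \<notin> {x, y, z}" using xyz by simp
    show "(\<Prod>v\<in>{x, y, z}. v \<bullet> dual_reflection (n j) (c j) m) = (\<Prod>v\<in>{x, y, z}. v \<bullet> m)" for j m
      using dist[of j] nc[of j] \<delta> unfolding V[of j]
      by (simp add: dual_reflection_boundary nX dual_reflection_center)
    show "trajectory n c m 3 = m" for m
    proof -
      have "n 1 = y \<times> z" "n 2 = z \<times> x" "n 3 = x \<times> y" "c 1 = x" "c 2 = y" "c 3 = z"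
        by (simp_all add: n_def c_def X_def)
      moreover have "n 1 \<bullet> c 1 \<noteq> 0" "n 2 \<bullet> c 2 \<noteq> 0" "n 3 \<bullet> c 3 \<noteq> 0"
        using nc \<delta> by simp_all
      ultimately have "v \<bullet> trajectory n c m 3 = v \<bullet> m" if "v \<in> {x, y, z}" for v
        using that
        by (auto simp: eval_nat_numeral dual_reflection_boundary dual_reflection_center dot_cross_self)
      then have "(trajectory n c m 3 - m) \<bullet> v = 0" if "v \<in> {x, y, z}" for v
        using that by (metis eq_iff_diff_eq_0 inner_commute inner_diff_right)
      then have "trajectory n c m 3 - m = 0"
        using eq_0_if_orthogonal_to_basis[of x y z "trajectory n c m 3 - m"] \<delta>
        unfolding \<delta>_def by blast
      then show ?thesis by simp
    qed
  qed simp
qed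

section \<open>Centrally-projective polygons\<close>

text \<open>With \<open>n \<bullet> c = 1\<close> the reflection is \<open>m \<mapsto> 2 (c \<bullet> m) n - m\<close>, and it preserves \<open>c \<bullet> m\<close>.\<close>
lemma trajectory_central:
  assumes "\<And>j. n j \<bullet> c = 1"
  shows "trajectory n (\<lambda>_. c) m j
    = (-1) ^ j *\<^sub>R (m - (2 * (c \<bullet> m)) *\<^sub>R (\<Sum>i<j. (-1) ^ i *\<^sub>R n (Suc i)))"
proof (induction j)
  case (Suc j)
  have "c \<bullet> trajectory n (\<lambda>_. c) m j = c \<bullet> m"
    by (induction j) (simp_all add: assms dual_reflection_center)
  then have "trajectory n (\<lambda>_. c) m (Suc j) = (2 * (c \<bullet> m)) *\<^sub>R n (Suc j) - trajectory n (\<lambda>_. c) m j"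
    by (simp add: dual_reflection_def assms)
  moreover have "(2 * (c \<bullet> m)) *\<^sub>R n (Suc j) = (-1) ^ j *\<^sub>R (2 * (c \<bullet> m)) *\<^sub>R (-1) ^ j *\<^sub>R n (Suc j)"
    by (simp flip: power_mult_distrib)
  ultimately show ?case
    unfolding Suc by (simp add: algebra_simps)
qed simp

text \<open>All centrally-projective cases reduce to this criterion: normalize the normals of the sides by
\<open>n \<bullet> c = 1\<close>; then their alternating sum over an even period has to vanish.  The invariant of
orientations is \<open>c \<bullet> m\<close>, that is, each oriented segment induces one and the same orientation on the
quotient of \<open>\<real>\<^sup>3\<close> by the center.\<close>
theorem reflective_centrally_projective:
  fixes n x :: "nat \<Rightarrow> real^3"
  assumes N: "length Ps = N" "N > 0" and k: "N dvd k" "even k" "2 \<le> k"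
    and x: "\<And>j. Ps ! (j mod N) = pt (x j)" "\<And>j. x j \<times> x (Suc j) \<noteq> 0"
    and normal: "\<And>j. n j \<bullet> x j = 0" "\<And>j. n j \<bullet> x (Suc j) = 0" "\<And>j. n j \<bullet> c = 1"
    and per: "\<And>j. n (j + N) = n j"
    and consecutive: "\<And>j. n j \<noteq> n (Suc j)"
    and alternating: "(\<Sum>i<k. (-1) ^ i *\<^sub>R n (Suc i)) = 0"
  shows "reflective k (centrally_projective (pt c) Ps)"
proof -
  let ?B = "centrally_projective (pt c) Ps"
  have n0: "n j \<noteq> 0" for j using normal(3)[of j] by auto
  have "c \<noteq> 0" using normal(3)[of 0] by auto
  have line: "line_through (pt (x j)) (pt (x (Suc j))) = dual_line (n j)" for j
    by (intro line_through_eq_dual_line n0 normal x)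
  have B: "length ?B = N" "?B ! (j mod N) = (dual_line (n j), \<lambda>q. line_through q (pt c))" for j
    using N line[of j] x(1)[of j] x(1)[of "Suc j"]
    by (simp_all add: centrally_projective_def framed_def mod_Suc_eq)
  have per': "n (j + q * N) = n j" for j q
  proof (induction q)
    case (Suc q)
    then show ?case using per[of "j + q * N"] by (simp add: algebra_simps)
  qed simp
  show ?thesis
  proof (rule reflective_of_closed_trajectories[where n = n and c = "\<lambda>_. c" and V = "{c}"])
    show "length ?B dvd k" using B k by simp
    show "boundary ?B j = dual_line (n j)" for j by (simp add: boundary_def B)
    show "transverse_field ?B j q = line_through q (pt c)" for j q
      by (simp add: transverse_field_def B)
    show "n (j + k) = n j" for j using k(1) per' by (auto simp: dvd_def mult.commute)
    show "n j \<times> n (Suc j) \<noteq> 0" for j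
    proof
      assume "n j \<times> n (Suc j) = 0"
      then obtain s where "n (Suc j) = s *\<^sub>R n j" using cross_eq_0_imp_scaleR n0 by blast
      moreover from this have "s = 1" using normal(3)[of j] normal(3)[of "Suc j"] by simp
      ultimately show False using consecutive[of j] by simp
    qed
    show "trajectory n (\<lambda>_. c) m k = m" for m
      using k by (simp add: trajectory_central normal alternating)
  qed (use k \<open>c \<noteq> 0\<close> in \<open>simp_all add: normal dual_reflection_center\<close>)
qed

lemma central_base_normals:
  assumes "central_base C Ps" "Ps \<noteq> []"
  obtains c and n x :: "nat \<Rightarrow> real^3" where "c \<noteq> 0" "C = pt c"
    "\<And>j. x j \<noteq> 0" "\<And>j. Ps ! (j mod length Ps) = pt (x j)" "\<And>j. x j \<times> x (Suc j) \<noteq> 0"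
    "\<And>j. n j \<bullet> x j = 0" "\<And>j. n j \<bullet> x (Suc j) = 0" "\<And>j. n j \<bullet> c = 1"
    "\<And>j. n (j + length Ps) = n j" "\<And>j. x (j + length Ps) = x j"
proof -
  obtain c where c: "c \<noteq> 0" "C = pt c" using rp2_cases .
  define x where "x = (\<lambda>j. SOME v. v \<noteq> 0 \<and> Ps ! (j mod length Ps) = pt v)"
  have x: "x j \<noteq> 0 \<and> Ps ! (j mod length Ps) = pt (x j)" for j
    unfolding x_def by (rule someI_ex) (metis rp2_cases)
  define n where "n = (\<lambda>j. (1 / ((x j \<times> x (Suc j)) \<bullet> c)) *\<^sub>R (x j \<times> x (Suc j)))"
  have xc: "(x j \<times> x (Suc j)) \<bullet> c \<noteq> 0" for j
  proof -
    have "\<not> aligned (Ps ! (j mod length Ps)) (Ps ! (Suc j mod length Ps)) C"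
      using assms unfolding central_base_def
      by (metis Suc_eq_plus1 length_greater_0_conv mod_Suc_eq mod_less_divisor)
    then show ?thesis
      using not_aligned_imp_triple_product x c by metis
  qed
  have xper: "x (j + length Ps) = x j" for j by (simp add: x_def)
  show ?thesis
  proof (rule that[of c x n])
    show "n (j + length Ps) = n j" for j
      using xper[of j] xper[of "Suc j"] by (simp add: n_def)
    show "x j \<times> x (Suc j) \<noteq> 0" for j using xc[of j] by auto
    show "n j \<bullet> c = 1" for j using xc[of j] by (simp add: n_def)
  qed (use c x xper in \<open>simp_all add: n_def dot_cross_self\<close>)
qed

text \<open>Writing the center as a combination of opposite vertices \<open>x 0\<close>, \<open>x 2\<close> shows that the normalized
normals of the two sides not containing \<open>x 0\<close> take the same value at \<open>x 0\<close>; the same holds at each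
vertex.  So the alternating sum of the four normals vanishes at \<open>x 0\<close>, \<open>x 1\<close> and \<open>c\<close>.\<close>
theorem reflective_central_quadrilateral:
  assumes base: "central_base C [P1, P2, P3, P4]"
    and C: "line_through P1 P3 \<inter> line_through P2 P4 = {C}"
  shows "reflective 4 (centrally_projective C [P1, P2, P3, P4])"
proof -
  have "[P1, P2, P3, P4] \<noteq> []" "length [P1, P2, P3, P4] = 4" by simp_all
  then obtain c and n x :: "nat \<Rightarrow> real^3" where *: "c \<noteq> 0" "C = pt c"
    "\<And>j. x j \<noteq> 0" "\<And>j. [P1, P2, P3, P4] ! (j mod 4) = pt (x j)" "\<And>j. x j \<times> x (Suc j) \<noteq> 0"
    "\<And>j. n j \<bullet> x j = 0" "\<And>j. n j \<bullet> x (Suc j) = 0" "\<And>j. n j \<bullet> c = 1"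
    "\<And>j. n (j + 4) = n j" "\<And>j. x (j + 4) = x j"
    using central_base_normals[OF base] by metis
  have P: "P1 = pt (x 0)" "P2 = pt (x 1)" "P3 = pt (x 2)" "P4 = pt (x 3)"
    using *(4)[of 0] *(4)[of 1] *(4)[of 2] *(4)[of 3] by simp_all
  have "pt c \<in> points_of (span {x 0, x 2})" "pt c \<in> points_of (span {x 1, x 3})"
    using C *(2,3) by (auto simp: P line_through_pt)
  then have "c \<in> span {x 0, x 2}" "c \<in> span {x 1, x 3}"
    using *(1) by (simp_all add: pt_in_points_of)
  moreover have "\<exists>s t. c = s *\<^sub>R y + t *\<^sub>R z" if "c \<in> span {y, z}" for y z
    using that by (auto simp: span_insert span_singleton algebra_simps)
  ultimately obtain \<alpha> \<beta> \<gamma> \<kappa>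
    where c: "c = \<alpha> *\<^sub>R x 0 + \<beta> *\<^sub>R x 2" "c = \<gamma> *\<^sub>R x 1 + \<kappa> *\<^sub>R x 3"
    by metis
  have z: "n 0 \<bullet> x 0 = 0" "n 0 \<bullet> x 1 = 0" "n 1 \<bullet> x 1 = 0" "n 1 \<bullet> x 2 = 0"
    "n 2 \<bullet> x 2 = 0" "n 2 \<bullet> x 3 = 0" "n 3 \<bullet> x 3 = 0" "n 3 \<bullet> x 0 = 0"
    using *(6)[of 0] *(6)[of 1] *(6)[of 2] *(6)[of 3]
      *(7)[of 0] *(7)[of 1] *(7)[of 2] *(7)[of 3] *(10)[of 0]
    by (simp_all add: eval_nat_numeral)
  have \<alpha>\<beta>: "n j \<bullet> c = \<alpha> * (n j \<bullet> x 0) + \<beta> * (n j \<bullet> x 2)" for j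
    unfolding c(1) by (simp add: inner_add_right)
  have \<gamma>\<kappa>: "n j \<bullet> c = \<gamma> * (n j \<bullet> x 1) + \<kappa> * (n j \<bullet> x 3)" for j
    unfolding c(2) by (simp add: inner_add_right)
  have a: "\<beta> * (n 0 \<bullet> x 2) = 1" "\<alpha> * (n 1 \<bullet> x 0) = 1" "\<alpha> * (n 2 \<bullet> x 0) = 1" "\<beta> * (n 3 \<bullet> x 2) = 1"
    using \<alpha>\<beta>[of 0] \<alpha>\<beta>[of 1] \<alpha>\<beta>[of 2] \<alpha>\<beta>[of 3] z *(8) by simp_all
  have b: "\<kappa> * (n 0 \<bullet> x 3) = 1" "\<kappa> * (n 1 \<bullet> x 3) = 1" "\<gamma> * (n 2 \<bullet> x 1) = 1" "\<gamma> * (n 3 \<bullet> x 1) = 1"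
    using \<gamma>\<kappa>[of 0] \<gamma>\<kappa>[of 1] \<gamma>\<kappa>[of 2] \<gamma>\<kappa>[of 3] z *(8) by simp_all
  have e: "n 1 \<bullet> x 0 = n 2 \<bullet> x 0" "n 2 \<bullet> x 1 = n 3 \<bullet> x 1"
    using a(2,3) b(3,4) by (metis mult_cancel_left mult_zero_left zero_neq_one)+
  define w where "w = n 1 - n 2 + n 3 - n 0"
  have "w \<bullet> x 0 = 0" "w \<bullet> x 1 = 0" "w \<bullet> c = 0"
    using z e *(8) by (simp_all add: w_def inner_diff_left inner_add_left)
  moreover have "(x 0 \<times> x 1) \<bullet> c \<noteq> 0"
  proof
    assume "(x 0 \<times> x 1) \<bullet> c = 0"
    moreover have "(x 0 \<times> x 1) \<times> n 0 = 0"
      using z cross_skew[of "x 0 \<times> x 1" "n 0"] by (simp add: Lagrange)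
    then obtain s where "n 0 = s *\<^sub>R (x 0 \<times> x 1)"
      using cross_eq_0_imp_scaleR *(5)[of 0] by auto
    ultimately show False using *(8)[of 0] by simp
  qed
  ultimately have w: "w = 0" using eq_0_if_orthogonal_to_basis by blast
  have red: "n j = n (j mod 4)" for j
  proof (induction j rule: less_induct)
    case (less j)
    show ?case
    proof (cases "j < 4")
      case False
      then show ?thesis using less[of "j - 4"] *(9)[of "j - 4"] by (simp add: mod_if)
    qed simp
  qed
  show ?thesis
    unfolding *(2)
  proof (rule reflective_centrally_projective[where N = 4 and n = n and x = x])
    have "n 0 \<noteq> n 1" using a(1) z(4) by auto
    have "n 1 \<noteq> n 2" using b(2) z(6) by auto
    have "n 2 \<noteq> n 3" using a(3) z(8) by auto
    have "n 3 \<noteq> n 0" using b(4) z(2) by auto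
    have ne: "n r \<noteq> n (if Suc r = 4 then 0 else Suc r)" if "r < 4" for r
    proof -
      have "r = 0 \<or> r = 1 \<or> r = 2 \<or> r = 3" using that by linarith
      then show ?thesis
        using \<open>n 0 \<noteq> n 1\<close> \<open>n 1 \<noteq> n 2\<close> \<open>n 2 \<noteq> n 3\<close> \<open>n 3 \<noteq> n 0\<close>
        by (elim disjE) (simp_all add: eval_nat_numeral)
    qed
    show "n j \<noteq> n (Suc j)" for j
      using ne[of "j mod 4"] red[of j] red[of "Suc j"] by (simp add: mod_Suc)
    have "n 4 = n 0" using *(9)[of 0] by simp
    then show "(\<Sum>i<4. (-1) ^ i *\<^sub>R n (Suc i)) = 0"
      using w by (simp add: w_def eval_nat_numeral)
  qed (use * in simp_all)
qed

text \<open>Going around twice, the side \<open>j\<close> occurs at the steps \<open>j\<close> and \<open>j + N\<close>, which have opposite signs in the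
alternating sum because \<open>N\<close> is odd.\<close>
theorem reflective_central_odd_polygon:
  assumes N: "length Ps = N" "N \<ge> 3" "odd N"
    and base: "central_base C Ps" and nondeg: "nondegenerate_polygon Ps"
  shows "reflective (2 * N) (centrally_projective C Ps)"
proof -
  have "Ps \<noteq> []" using N by auto
  then obtain c and n x :: "nat \<Rightarrow> real^3" where *: "c \<noteq> 0" "C = pt c"
    "\<And>j. x j \<noteq> 0" "\<And>j. Ps ! (j mod N) = pt (x j)" "\<And>j. x j \<times> x (Suc j) \<noteq> 0"
    "\<And>j. n j \<bullet> x j = 0" "\<And>j. n j \<bullet> x (Suc j) = 0" "\<And>j. n j \<bullet> c = 1"
    "\<And>j. n (j + N) = n j"
    using central_base_normals[OF base] unfolding N(1) by metis
  show ?thesis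
    unfolding *(2)
  proof (rule reflective_centrally_projective[where N = N and n = n and x = x])
    show "n j \<noteq> n (Suc j)" for j
    proof
      assume eq: "n j = n (Suc j)"
      have "n j \<noteq> 0" using *(8)[of j] by auto
      moreover have "n j \<bullet> x (Suc (Suc j)) = 0" unfolding eq by (rule *(7))
      ultimately have "aligned (pt (x j)) (pt (x (Suc j))) (pt (x (Suc (Suc j))))"
        using * alignedI by metis
      moreover have "\<not> aligned (Ps ! (j mod N)) (Ps ! ((j mod N + 1) mod N)) (Ps ! ((j mod N + 2) mod N))"
        using nondeg N unfolding nondegenerate_polygon_def by auto
      moreover have "(j mod N + 1) mod N = Suc j mod N" "(j mod N + 2) mod N = Suc (Suc j) mod N"
        by (simp_all add: mod_simps)
      ultimately show False using *(4) by metis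
    qed
    have "(\<Sum>i<N + M. (-1) ^ i *\<^sub>R n (Suc i)) =
        (\<Sum>i<N. (-1) ^ i *\<^sub>R n (Suc i)) - (\<Sum>i<M. (-1) ^ i *\<^sub>R n (Suc i))" for M
    proof (induction M)
      case (Suc M)
      have "n (Suc (N + M)) = n (Suc M)" using *(9)[of "Suc M"] by (simp add: add.commute)
      then show ?case using Suc N(3) by (simp add: power_add)
    qed simp
    from this[of N] show "(\<Sum>i<2 * N. (-1) ^ i *\<^sub>R n (Suc i)) = 0" by (simp add: mult_2)
  qed (use N * in simp_all)
qed

lemma alternating_sum_rotations:
  fixes \<zeta> :: complex
  assumes "\<zeta> ^ N = 1" "\<zeta> \<noteq> - 1" "even N"
  shows "(\<Sum>i<N. (-1) ^ i * \<zeta> ^ i) = 0"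
proof -
  have "(\<Sum>i<N. (- \<zeta>) ^ i) = 0"
    using assms by (simp add: sum_gp_strict) (metis add.inverse_inverse)
  then show ?thesis by (simp add: power_minus[of \<zeta>])
qed

text \<open>In the affine chart, the side \<open>j\<close> has the midpoint \<open>c + q j\<close> and is perpendicular to \<open>q j\<close>, so its
normalized equation at \<open>c + w\<close> is \<open>1 - (w \<bullet> q j) / h\<close> with \<open>h\<close> the squared distance of the sides from the
center.  The constants cancel in the alternating sum as \<open>N\<close> is even, and the vectors \<open>q j\<close> because
their alternating sum is geometric with ratio \<open>- \<zeta>\<close>, where \<open>\<zeta>\<close> is the rotation by one vertex.\<close>
theorem reflective_regular_even_polygon:
  assumes N: "length zs = N" "N \<ge> 4" "even N" and reg: "regular_polygon c zs"
  shows "reflective N (centrally_projective (affine_pt c) (map affine_pt zs))"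
proof -
  obtain \<rho> \<zeta> where \<rho>: "\<rho> \<noteq> 0" and \<zeta>: "\<zeta> = cis (2 * pi / N) \<or> \<zeta> = cis (- (2 * pi / N))"
    and zs: "\<And>j. j < N \<Longrightarrow> zs ! j = c + \<rho> * \<zeta> ^ j"
  proof -
    obtain \<rho> where \<rho>: "\<rho> \<noteq> 0" "(\<forall>j < N. zs ! j = c + \<rho> * cis (2 * pi * real j / real N)) \<or>
         (\<forall>j < N. zs ! j = c + \<rho> * cis (- 2 * pi * real j / real N))"
      using reg N(1) unfolding regular_polygon_def by auto
    moreover have "cis (2 * pi * real j / real N) = cis (2 * pi / N) ^ j"
      "cis (- 2 * pi * real j / real N) = cis (- (2 * pi / N)) ^ j" for j
      by (simp_all add: Complex.DeMoivre mult_ac)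
    ultimately show ?thesis using that by metis
  qed
  have "sin (2 * pi / N) > 0"
    using N by (intro sin_gt_zero) (auto simp: field_simps)
  then have "Im \<zeta> \<noteq> 0" using \<zeta> by auto
  then have \<zeta>1: "\<zeta> \<noteq> 1" "\<zeta> \<noteq> - 1" "\<zeta> \<noteq> 0" by auto
  have \<zeta>N: "\<zeta> ^ N = 1"
  proof -
    have "cis (2 * pi) = 1" "cis (- (2 * pi)) = 1" by (simp_all add: complex_eq_iff)
    then show ?thesis using \<zeta> N by (auto simp: Complex.DeMoivre)
  qed
  have norm\<zeta>: "cmod \<zeta> = 1" using \<zeta> by auto
  define a where "a = (\<lambda>j. \<rho> * \<zeta> ^ j)"
  define q where "q = (\<lambda>j. (a j + a (Suc j)) / 2)"
  define h where "h = (cmod (\<rho> * (1 + \<zeta>) / 2))\<^sup>2"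
  have q: "q j = \<rho> * (1 + \<zeta>) / 2 * \<zeta> ^ j" for j
    by (simp add: q_def a_def algebra_simps)
  have h: "(cmod (q j))\<^sup>2 = h" for j
    by (simp add: q h_def norm_mult norm_power norm\<zeta> norm_divide)
  have h0: "h \<noteq> 0" using \<zeta>1 \<rho> by (simp add: h_def add_eq_0_iff)
  have aq: "a (Suc j) = \<zeta> * a j" "q (Suc j) = \<zeta> * q j" for j by (simp_all add: a_def q)
  have a0: "a j \<noteq> 0" and q0: "q j \<noteq> 0" for j
    using \<rho> \<zeta>1 by (simp_all add: a_def q add_eq_0_iff)
  define v :: "complex \<Rightarrow> real^3" where "v = (\<lambda>z. vector [Re z, Im z, 1])"
  define A :: "complex \<Rightarrow> real^3" where
    "A = (\<lambda>q. vector [Re q / h, Im q / h, - (Re c * Re q + Im c * Im q) / h])"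
  \<comment> \<open>\<open>A q\<close> is the functional that is \<open>(w \<bullet> q) / h\<close> at the affine point \<open>c + w\<close>.\<close>
  define n where "n = (\<lambda>j. axis 3 1 - A (q j))"
  have A: "linear A"
    by (intro linearI)
      (simp_all add: A_def vec_eq_iff forall_3 add_divide_distrib algebra_simps diff_divide_distrib)
  have nv: "n j \<bullet> v (c + w) = 1 - (Re w * Re (q j) + Im w * Im (q j)) / h" for j w
    by (simp add: n_def A_def v_def inner_vec_def sum_3 axis_def algebra_simps add_divide_distrib diff_divide_distrib)
  have na: "n j \<bullet> v (c + a j) = 0" "n j \<bullet> v (c + a (Suc j)) = 0" for j
  proof -
    have "(cmod (a j))\<^sup>2 = (cmod (a (Suc j)))\<^sup>2"
      by (simp add: aq norm_mult norm\<zeta>)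
    then have "(Re (a j))\<^sup>2 + (Im (a j))\<^sup>2 = (Re (a (Suc j)))\<^sup>2 + (Im (a (Suc j)))\<^sup>2"
      by (simp add: cmod_power2)
    moreover have "Re (q j) = (Re (a j) + Re (a (Suc j))) / 2" "Im (q j) = (Im (a j) + Im (a (Suc j))) / 2"
      by (simp_all add: q_def)
    moreover have "a1 * p + a2 * r = p\<^sup>2 + r\<^sup>2 \<and> b1 * p + b2 * r = p\<^sup>2 + r\<^sup>2"
      if "a1\<^sup>2 + a2\<^sup>2 = b1\<^sup>2 + b2\<^sup>2" "p = (a1 + b1) / 2" "r = (a2 + b2) / 2"
      for a1 a2 b1 b2 p r :: real
      using that(1) unfolding that(2,3) by (simp add: power2_eq_square field_simps)
    moreover have "(Re (q j))\<^sup>2 + (Im (q j))\<^sup>2 = h" using h[of j] by (simp add: cmod_power2)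
    ultimately have "Re (a j) * Re (q j) + Im (a j) * Im (q j) = h"
      "Re (a (Suc j)) * Re (q j) + Im (a (Suc j)) * Im (q j) = h"
      by metis+
    then show "n j \<bullet> v (c + a j) = 0" "n j \<bullet> v (c + a (Suc j)) = 0"
      using h0 by (simp_all add: nv)
  qed
  have "reflective N (centrally_projective (pt (v c)) (map affine_pt zs))"
  proof (rule reflective_centrally_projective[where N = N and n = n and x = "\<lambda>j. v (c + a j)"])
    show "map affine_pt zs ! (j mod N) = pt (v (c + a j))" for j
    proof -
      have "\<zeta> ^ j = \<zeta> ^ (j mod N) * (\<zeta> ^ N) ^ (j div N)"
        by (simp flip: power_mult power_add)
      then have "\<zeta> ^ (j mod N) = \<zeta> ^ j" by (simp add: \<zeta>N)
      then show ?thesis using N zs[of "j mod N"] by (simp add: affine_pt_def v_def a_def)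
    qed
    show "v (c + a j) \<times> v (c + a (Suc j)) \<noteq> 0" for j
    proof
      assume "v (c + a j) \<times> v (c + a (Suc j)) = 0"
      then have "Re (a j) = Re (a (Suc j))" "Im (a j) = Im (a (Suc j))"
        by (simp_all add: v_def cross3_def vec_eq_iff forall_3)
      then have "a j = \<zeta> * a j" by (simp add: complex_eq_iff flip: aq)
      then show False using a0[of j] \<zeta>1 by simp
    qed
    show "n j \<bullet> v c = 1" for j using nv[of j 0] by simp
    show "n (j + N) = n j" for j by (simp add: n_def q power_add \<zeta>N)
    show "n j \<noteq> n (Suc j)" for j
    proof
      assume "n j = n (Suc j)"
      then have "Re (q j) = Re (q (Suc j))" "Im (q j) = Im (q (Suc j))"
        using h0 by (simp_all add: n_def A_def vec_eq_iff forall_3)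
      then have "q j = \<zeta> * q j" by (simp add: complex_eq_iff flip: aq)
      then show False using q0[of j] \<zeta>1 by simp
    qed
    have e: "(\<Sum>i<N. (-1::real) ^ i) = 0"
    proof -
      have "complex_of_real (\<Sum>i<N. (-1) ^ i) = 0" using alternating_sum_rotations[of 1 N] N by simp
      then show ?thesis using of_real_eq_0_iff by blast
    qed
    have "(\<Sum>i<N. (-1) ^ i *\<^sub>R q (Suc i)) = q 1 * (\<Sum>i<N. (-1) ^ i * \<zeta> ^ i)"
      by (simp add: q sum_distrib_left scaleR_conv_of_real mult_ac)
    then have "(\<Sum>i<N. (-1) ^ i *\<^sub>R q (Suc i)) = 0"
      using alternating_sum_rotations \<zeta>N \<zeta>1 N by simp
    then have "(\<Sum>i<N. (-1) ^ i *\<^sub>R A (q (Suc i))) = 0"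
      using linear_sum[OF A, of "\<lambda>i. (-1) ^ i *\<^sub>R q (Suc i)" "{..<N}"] linear_0[OF A]
      by (simp add: linear_scale[OF A])
    then show "(\<Sum>i<N. (-1) ^ i *\<^sub>R n (Suc i)) = 0"
      using e by (simp add: n_def scaleR_right_diff_distrib sum_subtractf flip: scaleR_left.sum)
  qed (use N na in simp_all)
  then show ?thesis by (simp add: affine_pt_def v_def)
qed

section \<open>The four families\<close>

theorem proposition3p7:
  shows "(\<forall>P1 P2 P3. \<not> aligned P1 P2 P3 \<longrightarrow> reflective 3 (right_spherical P1 P2 P3)) \<and>
    (\<forall>C P1 P2 P3 P4. central_base C [P1, P2, P3, P4] \<longrightarrow>
        line_through P1 P3 \<inter> line_through P2 P4 = {C} \<longrightarrow>
        reflective 4 (centrally_projective C [P1, P2, P3, P4])) \<and>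
    (\<forall>n c zs. n \<ge> 4 \<longrightarrow> even n \<longrightarrow> length zs = n \<longrightarrow> regular_polygon c zs \<longrightarrow>
        reflective n (centrally_projective (affine_pt c) (map affine_pt zs))) \<and>
    (\<forall>n C Ps. n \<ge> 3 \<longrightarrow> odd n \<longrightarrow> length Ps = n \<longrightarrow>
        central_base C Ps \<longrightarrow> nondegenerate_polygon Ps \<longrightarrow>
        reflective (2 * n) (centrally_projective C Ps))"
  using reflective_right_spherical reflective_central_quadrilateral
    reflective_regular_even_polygon reflective_central_odd_polygon by blast

end
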